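(* Let $\mathcal{X}$, $\mathcal{Y}$ be Polish spaces, $\gamma_0\in\mathcal{P}(\mathcal{Y})$, and let $\psi:\mathcal{P}(\mathcal{X})\times\mathcal{Y}\to\mathcal{X}$ be Borel measurable. For each $N\in\mathbb{N}$ let $X^N_1,\dots,X^N_N$ be $\mathcal{X}$-valued random variables on a probability space $(\Omega_N,\mathcal{F}_N,\mathbf{P}_N)$ with empirical measure $\mu^N=\frac1N\sum_{i=1}^N\delta_{X^N_i}$, and suppose there are independent and identically distributed $\mathcal{Y}$-valued random variables $Y^N_1,\dots,Y^N_N$ on $(\Omega_N,\mathcal{F}_N,\mathbf{P}_N)$ with common distribution $\gamma_0$ such that for all $i\in\{1,\dots,N\}$, $$X^N_i(\omega)=\psi\bigl(\mu^N_\omega,Y^N_i(\omega)\bigr)\quad\text{for }\mathbf{P}_N\text{-almost all }\omega\in\Omega_N.$$ For $\gamma\in\mathcal{P}(\mathcal{Y})$ and $\mu\in\mathcal{P}(\mathcal{X})$ let $\Psi_\gamma(\mu)=\gamma\circ\psi^{-1}(\mu,\cdot)$ be the image measure of $\gamma$ under $y\mapsto\psi(\mu,y)$. Assume that there is a Borel measurable set $\mathcal{D}\subset\mathcal{P}(\mathcal{Y})$ such that: (A1) for every $\gamma\in\mathcal{D}$ the equation $\mu=\Psi_\gamma(\mu)$ has a unique solution $\mu_\ast(\gamma)\in\mathcal{P}(\mathcal{X})$, and the mapping $\mathcal{D}\ni\gamma\mapsto\mu_\ast(\gamma)\in\mathcal{P}(\mathcal{X})$ is Borel measurable; (A2) for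 all $N\in\mathbb{N}$, $\otimes^N\gamma_0\bigl\{(y_1,\dots,y_N)\in\mathcal{Y}^N:\frac1N\sum_{i=1}^N\delta_{y_i}\in\mathcal{D}\bigr\}=1$; (A3) if $\gamma\in\mathcal{P}(\mathcal{Y})$ is such that $R(\gamma\|\gamma_0)<\infty$, then $\gamma\in\mathcal{D}$ and $\mu_{\ast|\mathcal{D}}$ is continuous at $\gamma$. Then the sequence $(\mu^N)_{N\in\mathbb{N}}$ of $\mathcal{P}(\mathcal{X})$-valued random variables satisfies the large deviation principle with good rate function $I:\mathcal{P}(\mathcal{X})\to[0,\infty]$ given by $$I(\eta)=\inf_{\gamma\in\mathcal{D}:\,\mu_\ast(\gamma)=\eta}R(\gamma\|\gamma_0),$$ where $\inf\varnothing=\infty$ by convention.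
   Context: For a Polish space $\mathcal{S}$, $\mathcal{P}(\mathcal{S})$ is the space of probability measures on the Borel $\sigma$-algebra $\mathcal{B}(\mathcal{S})$ with the topology of weak convergence. The relative entropy is $R(\nu\|\mu)=\int_{\mathcal{S}}\log\bigl(\frac{d\nu}{d\mu}\bigr)d\nu$ if $\nu$ is absolutely continuous with respect to $\mu$, and $R(\nu\|\mu)=\infty$ otherwise. A rate function on $\mathcal{S}$ is a lower semicontinuous function $I:\mathcal{S}\to[0,\infty]$; it is good if its sublevel sets $I^{-1}([0,c])$, $c\in[0,\infty)$, are compact. A sequence $(\xi^n)_{n\in\mathbb{N}}$ of $\mathcal{S}$-valued random variables (possibly defined on different probability spaces) satisfies the large deviation principle with rate function $I$ if for all $B\in\mathcal{B}(\mathcal{S})$, $$-\inf_{x\in B^\circ}I(x)\le\liminf_{n\to\infty}\tfrac1n\log\mathbf{P}\{\xi^n\in B\}\le\limsup_{n\to\infty}\tfrac1n\log\mathbf{P}\{\xi^n\in B\}\le-\inf_{x\in\mathrm{cl}(B)}I(x),$$ where $B^\circ$ is the interior and $\mathrm{cl}(B)$ the closure of $B$. $\delta_x$ is the Dirac measure at $x$. *)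

theory Defs
  imports "HOL-Probability.Probability"
begin

section \<open>The space of Borel probability measures with the weak topology\<close>

typedef (overloaded) ('a::topological_space) prob =
  "{M :: 'a measure. prob_space M \<and> sets M = sets borel}"
  morphisms measure_of_prob Prob
proof
  show "return borel undefined \<in> {M :: 'a measure. prob_space M \<and> sets M = sets borel}"
    by (simp add: prob_space_return)
qed

text \<open>Weak convergence: the coarsest topology for which \<open>\<mu> \<mapsto> \<integral>f d\<mu>\<close> is continuous for every
  bounded continuous real function \<open>f\<close> (see \<open>tendsto_prob_iff\<close> below).\<close>

instantiation prob :: (topological_space) topological_space
begin

definition open_prob :: "'a prob set \<Rightarrow> bool" where
  "open_prob = generate_topology
     {{\<mu>. (\<integral>x. f x \<partial>measure_of_prob \<mu>) \<in> V} | (f :: 'a \<Rightarrow> real) V.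
        continuous_on UNIV f \<and> bounded (range f) \<and> open V}"

instance
  by standard (auto simp: open_prob_def intro: generate_topology.intros)

end

lemma prob_space_measure_of_prob: "prob_space (measure_of_prob \<mu>)"
  and sets_measure_of_prob [simp, measurable_cong]: "sets (measure_of_prob \<mu>) = sets borel"
  using measure_of_prob[of \<mu>] by auto

lemma space_measure_of_prob [simp]: "space (measure_of_prob \<mu>) = UNIV"
  using sets_eq_imp_space_eq[OF sets_measure_of_prob[of \<mu>]] by simp

lemma tendsto_prob_iff:
  fixes g :: "'b \<Rightarrow> 'a::topological_space prob"
  shows "(g \<longlongrightarrow> \<mu>) F \<longleftrightarrow>
    (\<forall>f :: 'a \<Rightarrow> real. continuous_on UNIV f \<longrightarrow> bounded (range f) \<longrightarrow>
      ((\<lambda>b. \<integral>x. f x \<partial>measure_of_prob (g b)) \<longlongrightarrow> (\<integral>x. f x \<partial>measure_of_prob \<mu>)) F)"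
    (is "?L \<longleftrightarrow> ?R")
proof
  assume L: ?L
  show ?R
  proof (intro allI impI topological_tendstoI)
    fix f :: "'a \<Rightarrow> real" and V :: "real set"
    assume f: "continuous_on UNIV f" "bounded (range f)" and V: "open V"
      and mem: "(\<integral>x. f x \<partial>measure_of_prob \<mu>) \<in> V"
    have "open {\<mu>. (\<integral>x. f x \<partial>measure_of_prob \<mu>) \<in> V}"
      unfolding open_prob_def using f V by (intro generate_topology.Basis) blast
    from topological_tendstoD[OF L this] mem
    show "\<forall>\<^sub>F b in F. (\<integral>x. f x \<partial>measure_of_prob (g b)) \<in> V" by simp
  qed
next
  assume R: ?R
  show ?L
  proof (rule topological_tendstoI)
    fix U :: "'a prob set" assume "open U" "\<mu> \<in> U"
    from this[unfolded open_prob_def] show "\<forall>\<^sub>F b in F. g b \<in> U"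
    proof (induction rule: generate_topology.induct)
      case (Int a b)
      then show ?case by (simp add: eventually_conj_iff)
    next
      case (UN K)
      then obtain k where "k \<in> K" "\<mu> \<in> k" by blast
      with UN.IH have "\<forall>\<^sub>F b in F. g b \<in> k" by blast
      then show ?case by eventually_elim (use \<open>k \<in> K\<close> in blast)
    next
      case (Basis s)
      then obtain f :: "'a \<Rightarrow> real" and V where
        s: "s = {\<mu>. (\<integral>x. f x \<partial>measure_of_prob \<mu>) \<in> V}"
        and f: "continuous_on UNIV f" "bounded (range f)" "open V" by blast
      with R Basis show ?case by (auto dest: topological_tendstoD)
    qed simp
  qed
qed

text \<open>Only meaningful for Borel measurable \<open>f\<close>.\<close>

definition image_prob :: "('a::topological_space \<Rightarrow> 'b::topological_space) \<Rightarrow> 'a prob \<Rightarrow> 'b prob" where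
  "image_prob f \<gamma> = Prob (distr (measure_of_prob \<gamma>) borel f)"

lemma measure_of_image_prob:
  assumes "f \<in> borel_measurable borel"
  shows "measure_of_prob (image_prob f \<gamma>) = distr (measure_of_prob \<gamma>) borel f"
proof -
  have "f \<in> measurable (measure_of_prob \<gamma>) borel"
    using assms by (simp cong: measurable_cong_sets)
  then show ?thesis
    unfolding image_prob_def
    by (subst Prob_inverse) (auto intro: prob_space.prob_space_distr prob_space_measure_of_prob)
qed

text \<open>The empirical measure \<open>(1/N) (\<delta>\<^bsub>x 1\<^esub> + \<dots> + \<delta>\<^bsub>x N\<^esub>)\<close>, meaningful for \<open>N \<ge> 1\<close>.\<close>

definition empirical_measure :: "nat \<Rightarrow> (nat \<Rightarrow> 'a::topological_space) \<Rightarrow> 'a prob" where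
  "empirical_measure N x = Prob (measure_of UNIV (sets borel)
     (\<lambda>A. ennreal (1 / real N) * (\<Sum>i\<in>{1..N}. emeasure (return borel (x i)) A)))"

lemma emeasure_empirical_measure:
  fixes x :: "nat \<Rightarrow> 'a::topological_space"
  assumes N: "N \<ge> 1" and A: "A \<in> sets borel"
  shows "emeasure (measure_of_prob (empirical_measure N x)) A =
    ennreal (1 / real N) * (\<Sum>i\<in>{1..N}. emeasure (return borel (x i)) A)"
proof -
  let ?m = "\<lambda>A. ennreal (1 / real N) * (\<Sum>i\<in>{1..N}. emeasure (return borel (x i)) A)"
  let ?M = "measure_of UNIV (sets borel) ?m"
  have sa: "sigma_algebra (UNIV :: 'a set) (sets borel)"
    using sets.sigma_algebra_axioms[of "borel :: 'a measure"] by simp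
  have ca: "countably_additive (sets (borel :: 'a measure)) ?m"
  proof (rule countably_additiveI)
    fix B :: "nat \<Rightarrow> 'a set"
    assume B: "range B \<subseteq> sets borel" "disjoint_family B" "\<Union> (range B) \<in> sets borel"
    have "(\<Sum>k. ?m (B k)) = ennreal (1 / real N) * (\<Sum>i\<in>{1..N}. \<Sum>k. emeasure (return borel (x i)) (B k))"
      by (simp add: suminf_sum[symmetric] del: emeasure_return)
    also have "\<dots> = ?m (\<Union> (range B))"
      using B by (simp add: suminf_emeasure del: emeasure_return)
    finally show "(\<Sum>k. ?m (B k)) = ?m (\<Union> (range B))" .
  qed
  have em: "emeasure ?M C = ?m C" if "C \<in> sets borel" for C
    by (rule emeasure_measure_of_sigma[OF sa _ ca that]) (simp add: positive_def)
  have sets: "sets ?M = sets borel"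
    by (rule sigma_algebra.sets_measure_of_eq[OF sa])
  have "prob_space ?M"
  proof (rule prob_spaceI)
    have "emeasure ?M (space ?M) = ?m UNIV"
      using em[of UNIV] by (simp add: space_measure_of_conv)
    also have "\<dots> = 1"
      using N by (simp add: ennreal_mult[symmetric] ennreal_of_nat_eq_real_of_nat)
    finally show "emeasure ?M (space ?M) = 1" .
  qed
  then have "measure_of_prob (empirical_measure N x) = ?M"
    unfolding empirical_measure_def using sets by (intro Prob_inverse) simp
  then show ?thesis using em[OF A] by simp
qed


section \<open>Relative entropy\<close>

text \<open>The integral of the log-density is taken in the extended sense, as the difference of the
  integrals of its positive and negative part; the latter is always finite. (The Bochner integral
  in \<open>KL_divergence\<close> is 0 instead of \<open>\<infinity>\<close> when the log-density is not integrable; otherwise the two agree.)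
  Recall that \<open>absolutely_continuous \<mu> \<nu>\<close> is \<open>\<nu> \<lless> \<mu>\<close> and \<open>RN_deriv \<mu> \<nu>\<close> is \<open>d\<nu>/d\<mu>\<close>.\<close>

definition relative_entropy :: "'a::topological_space prob \<Rightarrow> 'a prob \<Rightarrow> ereal" where
  "relative_entropy \<nu> \<mu> =
     (let P = measure_of_prob \<mu>; Q = measure_of_prob \<nu>;
          L = (\<lambda>x. ln (enn2real (RN_deriv P Q x)))
      in if absolutely_continuous P Q
         then enn2ereal (\<integral>\<^sup>+x. ennreal (L x) \<partial>Q) - enn2ereal (\<integral>\<^sup>+x. ennreal (- L x) \<partial>Q)
         else \<infinity>)"

lemma relative_entropy_eq_KL_divergence:
  assumes "absolutely_continuous (measure_of_prob \<mu>) (measure_of_prob \<nu>)"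
    and "integrable (measure_of_prob \<nu>)
           (entropy_density (exp 1) (measure_of_prob \<mu>) (measure_of_prob \<nu>))"
  shows "relative_entropy \<nu> \<mu> = ereal (KL_divergence (exp 1) (measure_of_prob \<mu>) (measure_of_prob \<nu>))"
proof -
  let ?Q = "measure_of_prob \<nu>"
  let ?L = "\<lambda>x. ln (enn2real (RN_deriv (measure_of_prob \<mu>) ?Q x))"
  have e: "entropy_density (exp 1) (measure_of_prob \<mu>) ?Q = ?L"
    by (simp add: entropy_density_def fun_eq_iff log_def)
  have i: "integrable ?Q ?L" using assms(2) e by simp
  have fin: "(\<integral>\<^sup>+x. ennreal (?L x) \<partial>?Q) < \<infinity>" "(\<integral>\<^sup>+x. ennreal (- ?L x) \<partial>?Q) < \<infinity>"
    using i by (auto simp: real_integrable_def less_top)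
  have "KL_divergence (exp 1) (measure_of_prob \<mu>) ?Q =
      enn2real (\<integral>\<^sup>+x. ennreal (?L x) \<partial>?Q) - enn2real (\<integral>\<^sup>+x. ennreal (- ?L x) \<partial>?Q)"
    unfolding KL_divergence_def e by (rule real_lebesgue_integral_def[OF i])
  with fin assms(1) show ?thesis
    unfolding relative_entropy_def Let_def
    by (cases "\<integral>\<^sup>+x. ennreal (?L x) \<partial>?Q"; cases "\<integral>\<^sup>+x. ennreal (- ?L x) \<partial>?Q")
       (auto simp: enn2ereal_ennreal)
qed


section \<open>Large deviation principle\<close>

definition rate_function :: "('a::topological_space \<Rightarrow> ereal) \<Rightarrow> bool" where
  "rate_function I \<longleftrightarrow> (\<forall>x. 0 \<le> I x) \<and> (\<forall>x. I x \<le> Liminf (at x) I)"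

definition good_rate_function :: "('a::topological_space \<Rightarrow> ereal) \<Rightarrow> bool" where
  "good_rate_function I \<longleftrightarrow>
     rate_function I \<and> (\<forall>c::real. 0 \<le> c \<longrightarrow> compact {x. I x \<le> ereal c})"

definition log_ereal :: "real \<Rightarrow> ereal" where
  "log_ereal p = (if p = 0 then -\<infinity> else ereal (ln p))"

text \<open>The sequence starts at index 1, and the \<open>\<xi> n\<close> may live on different probability spaces \<open>P n\<close>.\<close>

definition large_deviation_principle ::
  "(nat \<Rightarrow> 'w measure) \<Rightarrow> (nat \<Rightarrow> 'w \<Rightarrow> 'a::topological_space) \<Rightarrow> ('a \<Rightarrow> ereal) \<Rightarrow> bool" where
  "large_deviation_principle P \<xi> I \<longleftrightarrow>
     rate_function I \<and>
     (\<forall>n\<ge>1. prob_space (P n) \<and> \<xi> n \<in> borel_measurable (P n)) \<and>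
     (\<forall>B\<in>sets borel.
        - (INF x\<in>interior B. I x)
          \<le> liminf (\<lambda>n. ereal (1 / real n) * log_ereal (measure (P n) {\<omega> \<in> space (P n). \<xi> n \<omega> \<in> B})) \<and>
        limsup (\<lambda>n. ereal (1 / real n) * log_ereal (measure (P n) {\<omega> \<in> space (P n). \<xi> n \<omega> \<in> B}))
          \<le> - (INF x\<in>closure B. I x))"

end

theory Submission
  imports Defs
begin

text \<open>The almost sure identities \<open>X\<^sub>i = \<psi>(\<mu>\<^sup>N, Y\<^sub>i)\<close> say that, for almost every outcome, \<open>\<mu>\<^sup>N\<close> solves the fixed-point
  equation \<open>\<eta> = \<Psi>\<^sub>\<gamma>(\<eta>)\<close> in which \<open>\<gamma>\<close> is the empirical measure of the noise \<open>Y\<^sub>1, \<dots>, Y\<^sub>N\<close>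
  (\<open>fixed_point_of_empirical_measure\<close>). This \<open>\<gamma>\<close> lies in \<open>D\<close> almost surely, so uniqueness of the solution gives
  \<open>\<mu>\<^sup>N = \<mu>_star \<gamma>\<close>. The noise is an i.i.d. sample, so the theorem is a contraction of the theorem of Sanov along
  \<open>\<mu>_star\<close>. That map may be discontinuous, but only at points of infinite entropy, and these do not affect the
  infima on either side (\<open>compact_sublevel_of_infimum_over_fibre\<close>, \<open>limit_point_in_closure_image\<close>).

  The theorem of Sanov rests on two facts about relative entropy. The Donsker--Varadhan formula
  (\<open>donsker_varadhan_le\<close>, \<open>relative_entropy_leI\<close>) describes \<open>{\<gamma>. R(\<gamma> | \<gamma>0) \<le> c}\<close> by the linear constraints
  \<open>\<integral>g d\<gamma> \<le> c + ln \<integral>e\<^sup>g d\<gamma>0\<close> for bounded Borel \<open>g\<close>. These constraints make sense for finitely additive means, which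
  form a compact space by Tychonoff, and they force a mean to be countably additive
  (\<open>entropic_mean_is_expectation\<close>). So entropy sublevels are compact, even in a topology finer than the weak one.
  The same compactness covers a closed set \<open>F\<close> disjoint from a sublevel by finitely many half-spaces
  \<open>\<integral>g d\<gamma> > c + ln \<integral>e\<^sup>g d\<gamma>0\<close> (\<open>closed_set_covered_by_halfspaces\<close>), and each of these has probability at most
  \<open>e\<close> to the power \<open>- N c\<close> by Markov's inequality. A union bound yields the
  upper bound (\<open>sanov_upper_bound\<close>).

  For the lower bound (\<open>sanov_lower_bound\<close>), let \<open>p\<close> and \<open>q\<close> be the probabilities that the empirical measure of \<open>N\<close>
  samples from \<open>\<gamma>0\<close> and from \<open>\<gamma>\<close> lies in an open neighbourhood of \<open>\<gamma>\<close>. The Gibbs inequality on the \<open>N\<close>-fold product gives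
  \<open>q ln p \<ge> - (N R(\<gamma> | \<gamma>0) + 1)\<close> (\<open>change_of_measure_iid\<close>), and \<open>q\<close> tends to 1 by the weak law of large numbers.\<close>

section \<open>Empirical measures\<close>

lemma measurable_measure_of_prob [simp]:
  "measurable (measure_of_prob \<gamma>) N = measurable borel N"
  by (rule measurable_cong_sets) auto

lemma measure_measure_of_prob_UNIV [simp]: "measure (measure_of_prob \<gamma>) UNIV = 1"
  using prob_space.prob_space[OF prob_space_measure_of_prob, of \<gamma>] by simp

lemma prob_eqI: "measure_of_prob \<mu> = measure_of_prob \<nu> \<Longrightarrow> \<mu> = \<nu>"
  by (simp add: measure_of_prob_inject)

text \<open>An empirical measure is the law of a uniformly chosen entry; hence integrals against it are
  averages, and taking images commutes with forming empirical measures.\<close>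

lemma measure_of_empirical_measure:
  fixes x :: "nat \<Rightarrow> 'a::topological_space"
  assumes "N \<ge> 1"
  shows "measure_of_prob (empirical_measure N x) =
    distr (measure_pmf (pmf_of_set {1..N})) borel x"
proof (rule measure_eqI)
  fix A :: "'a set" assume "A \<in> sets (measure_of_prob (empirical_measure N x))"
  then have A: "A \<in> sets borel" by simp
  have "emeasure (distr (measure_pmf (pmf_of_set {1..N})) borel x) A =
      ennreal (real (card ({1..N} \<inter> x -` A)) / real N)"
    using A assms
    by (simp add: emeasure_distr emeasure_pmf_of_set)
  also have "\<dots> = ennreal (1 / real N) * ennreal (real (card ({1..N} \<inter> x -` A)))"
    by (simp add: ennreal_mult[symmetric])
  also have "real (card ({1..N} \<inter> x -` A)) = (\<Sum>i\<in>{1..N}. indicator A (x i))"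
    by (simp add: indicator_def of_bool_def vimage_def Int_def flip: sum.inter_filter)
  also have "ennreal \<dots> = (\<Sum>i\<in>{1..N}. emeasure (return borel (x i)) A)"
    using A by (simp add: sum_ennreal[symmetric] ennreal_indicator)
  finally show "emeasure (measure_of_prob (empirical_measure N x)) A =
      emeasure (distr (measure_pmf (pmf_of_set {1..N})) borel x) A"
    using assms A by (simp add: emeasure_empirical_measure del: emeasure_return)
qed simp

lemma integral_empirical_measure:
  fixes f :: "'a::topological_space \<Rightarrow> real"
  assumes "N \<ge> 1" "f \<in> borel_measurable borel"
  shows "(\<integral>x. f x \<partial>measure_of_prob (empirical_measure N y)) = (\<Sum>i=1..N. f (y i)) / real N"
  using assms
  by (simp add: measure_of_empirical_measure integral_distr integral_pmf_of_set)

lemma empirical_measure_cong: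
  fixes x y :: "nat \<Rightarrow> 'a::topological_space"
  assumes "\<And>i. i \<in> {1..N} \<Longrightarrow> x i = y i"
  shows "empirical_measure N x = empirical_measure N y"
proof -
  have "(\<lambda>A. ennreal (1 / real N) * (\<Sum>i\<in>{1..N}. emeasure (return borel (x i)) A)) =
        (\<lambda>A. ennreal (1 / real N) * (\<Sum>i\<in>{1..N}. emeasure (return borel (y i)) A))"
    using assms by (intro ext arg_cong2[where f="(*)"] sum.cong) auto
  then show ?thesis by (simp add: empirical_measure_def)
qed

lemma empirical_measure_image_prob:
  assumes "N \<ge> 1" "f \<in> borel_measurable borel"
  shows "empirical_measure N (\<lambda>i. f (y i)) = image_prob f (empirical_measure N y)"
  using assms
  by (intro prob_eqI)
     (simp add: measure_of_image_prob measure_of_empirical_measure distr_distr comp_def)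

lemma continuous_empirical_measure:
  fixes N :: nat
  assumes "N \<ge> 1"
  shows "continuous_on UNIV (empirical_measure N :: (nat \<Rightarrow> 'a::topological_space) \<Rightarrow> 'a prob)"
  unfolding continuous_on_def
proof (intro ballI tendsto_prob_iff[THEN iffD2] allI impI)
  fix x :: "nat \<Rightarrow> 'a" and f :: "'a \<Rightarrow> real"
  assume f: "continuous_on UNIV f" "bounded (range f)"
  have "continuous_on UNIV (\<lambda>y::nat \<Rightarrow> 'a. (\<Sum>i=1..N. f (y i)) / real N)"
    using assms by (intro continuous_intros continuous_on_compose2[OF f(1)] continuous_on_product_coordinates) auto
  then show "((\<lambda>y. \<integral>x. f x \<partial>measure_of_prob (empirical_measure N y)) \<longlongrightarrow>
      (\<integral>x. f x \<partial>measure_of_prob (empirical_measure N x))) (at x)"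
    using assms f
    by (simp add: integral_empirical_measure borel_measurable_continuous_onI continuous_on_def)
qed

text \<open>The Borel \<open>\<sigma>\<close>-algebra of the weak topology contains arbitrary unions of subbasic sets, so
  measurability cannot be tested on integrals alone without knowing that topology to be second
  countable. Factoring through the continuous map from sequences to empirical measures avoids the
  question: a sequence space over a second countable space carries the product \<open>\<sigma>\<close>-algebra as its
  Borel \<open>\<sigma>\<close>-algebra.\<close>

lemma measurable_empirical_measure:
  fixes Y :: "nat \<Rightarrow> 'w \<Rightarrow> 'a::second_countable_topology"
  assumes "N \<ge> 1" "\<And>i. i \<in> {1..N} \<Longrightarrow> Y i \<in> borel_measurable M"
  shows "(\<lambda>\<omega>. empirical_measure N (\<lambda>i. Y i \<omega>)) \<in> borel_measurable M"
proof -
  have "(\<lambda>\<omega> i. if i \<in> {1..N} then Y i \<omega> else undefined) \<in> borel_measurable M"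
  proof (rule measurable_coordinatewise_then_product)
    show "(\<lambda>\<omega>. if i \<in> {1..N} then Y i \<omega> else undefined) \<in> borel_measurable M" for i
      using assms(2) by (cases "i \<in> {1..N}") auto
  qed
  from measurable_compose[OF this borel_measurable_continuous_onI[OF continuous_empirical_measure[OF assms(1)]]]
  have "(\<lambda>\<omega>. empirical_measure N (\<lambda>i. if i \<in> {1..N} then Y i \<omega> else undefined)) \<in> borel_measurable M" .
  also have "(\<lambda>\<omega>. empirical_measure N (\<lambda>i. if i \<in> {1..N} then Y i \<omega> else undefined)) =
      (\<lambda>\<omega>. empirical_measure N (\<lambda>i. Y i \<omega>))"
    by (intro ext empirical_measure_cong) auto
  finally show ?thesis .
qed

section \<open>The weak topology is Hausdorff\<close>

text \<open>The indicator of a closed set is the decreasing limit of bounded Lipschitz functions of the distance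
  to the set, so integrals of bounded continuous functions determine the measure of closed sets and,
  since these form an intersection-stable generator, the whole measure.\<close>

lemma measure_of_closed_eq_lim:
  fixes C :: "'a::metric_space set" and \<mu> :: "'a prob"
  assumes "closed C" "C \<noteq> {}"
  shows "(\<lambda>n. \<integral>x. max 0 (1 - real n * infdist x C) \<partial>measure_of_prob \<mu>) \<longlonglongrightarrow> measure (measure_of_prob \<mu>) C"
proof -
  interpret prob_space "measure_of_prob \<mu>" by (rule prob_space_measure_of_prob)
  have lim: "(\<lambda>n. max 0 (1 - real n * infdist x C)) \<longlonglongrightarrow> indicator C x" for x
  proof (cases "x \<in> C")
    case True then show ?thesis by simp
  next
    case False
    then have d: "infdist x C > 0"
      using assms infdist_pos_not_in_closed by blast
    obtain m :: nat where m: "1 / infdist x C < real m" using reals_Archimedean2 by blast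
    have "max 0 (1 - real n * infdist x C) = 0" if "n \<ge> m" for n
    proof -
      have "1 / infdist x C < real n" using m that by linarith
      then show ?thesis using d by (simp add: field_simps)
    qed
    then have "\<forall>\<^sub>F n in sequentially. max 0 (1 - real n * infdist x C) = 0"
      using eventually_sequentially by blast
    then show ?thesis using False by (simp add: tendsto_eventually)
  qed
  have "(\<lambda>n. \<integral>x. max 0 (1 - real n * infdist x C) \<partial>measure_of_prob \<mu>) \<longlonglongrightarrow>
     (\<integral>x. indicator C x \<partial>measure_of_prob \<mu>)"
  proof (rule integral_dominated_convergence[where w = "\<lambda>_. 1"])
    show "(\<lambda>x. max 0 (1 - real n * infdist x C)) \<in> borel_measurable (measure_of_prob \<mu>)" for n
      by (simp, intro borel_measurable_continuous_onI continuous_intros)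
    show "AE x in measure_of_prob \<mu>. norm (max 0 (1 - real n * infdist x C)) \<le> 1" for n
      by (auto intro!: AE_I2 infdist_nonneg mult_nonneg_nonneg)
  qed (use lim assms in auto)
  then show ?thesis using assms by simp
qed

lemma prob_eq_if_integrals_eq:
  fixes \<mu> \<nu> :: "'a::metric_space prob"
  assumes "\<And>f :: 'a \<Rightarrow> real. continuous_on UNIV f \<Longrightarrow> bounded (range f) \<Longrightarrow>
    (\<integral>x. f x \<partial>measure_of_prob \<mu>) = (\<integral>x. f x \<partial>measure_of_prob \<nu>)"
  shows "\<mu> = \<nu>"
proof (rule prob_eqI, rule measure_eqI_generator_eq[where E = "Collect closed" and A = "\<lambda>_. UNIV" and \<Omega> = UNIV])
  interpret M: prob_space "measure_of_prob \<mu>" by (rule prob_space_measure_of_prob)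
  interpret N: prob_space "measure_of_prob \<nu>" by (rule prob_space_measure_of_prob)
  show "emeasure (measure_of_prob \<mu>) ((\<lambda>_. UNIV) i) \<noteq> \<infinity>" for i :: nat
    by (simp add: M.emeasure_eq_measure)
  fix C :: "'a set" assume "C \<in> Collect closed"
  then have C: "closed C" by simp
  show "emeasure (measure_of_prob \<mu>) C = emeasure (measure_of_prob \<nu>) C"
  proof (cases "C = {}")
    case False
    have "bounded (range (\<lambda>x. max 0 (1 - real n * infdist x C)))" for n
      by (intro boundedI[where B=1]) (auto intro!: infdist_nonneg mult_nonneg_nonneg)
    then have "(\<integral>x. max 0 (1 - real n * infdist x C) \<partial>measure_of_prob \<mu>) =
        (\<integral>x. max 0 (1 - real n * infdist x C) \<partial>measure_of_prob \<nu>)" for n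
      by (intro assms continuous_intros)
    then have "measure (measure_of_prob \<mu>) C = measure (measure_of_prob \<nu>) C"
      using measure_of_closed_eq_lim[OF C False, of \<mu>] measure_of_closed_eq_lim[OF C False, of \<nu>]
      by (simp add: LIMSEQ_unique)
    then show ?thesis by (simp add: M.emeasure_eq_measure N.emeasure_eq_measure)
  qed simp
qed (auto simp: Int_stable_def borel_eq_closed)

instance prob :: (metric_space) t2_space
proof
  fix \<mu> \<nu> :: "'a prob"
  assume "\<mu> \<noteq> \<nu>"
  then obtain f :: "'a \<Rightarrow> real" where f: "continuous_on UNIV f" "bounded (range f)"
    and ne: "(\<integral>x. f x \<partial>measure_of_prob \<mu>) \<noteq> (\<integral>x. f x \<partial>measure_of_prob \<nu>)"
    using prob_eq_if_integrals_eq by metis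
  from hausdorff[OF ne] obtain U V where UV: "open U" "open V"
    "(\<integral>x. f x \<partial>measure_of_prob \<mu>) \<in> U" "(\<integral>x. f x \<partial>measure_of_prob \<nu>) \<in> V" "U \<inter> V = {}"
    by blast
  have op: "open {\<mu>. (\<integral>x. f x \<partial>measure_of_prob \<mu>) \<in> W}" if "open W" for W
    unfolding open_prob_def using f that by (intro generate_topology.Basis) blast
  show "\<exists>U V. open U \<and> open V \<and> \<mu> \<in> U \<and> \<nu> \<in> V \<and> U \<inter> V = {}"
    using UV op[OF UV(1)] op[OF UV(2)]
    by (intro exI[of _ "{\<mu>. (\<integral>x. f x \<partial>measure_of_prob \<mu>) \<in> U}"]
              exI[of _ "{\<mu>. (\<integral>x. f x \<partial>measure_of_prob \<mu>) \<in> V}"]) auto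
qed

section \<open>The variational formula for relative entropy\<close>

definition bounded_borel :: "('a::topological_space \<Rightarrow> real) set" where
  "bounded_borel = {f \<in> borel_measurable borel. bounded (range f)}"

lemma bounded_borelI:
  assumes "f \<in> borel_measurable borel" "\<And>x. \<bar>f x\<bar> \<le> B"
  shows "f \<in> bounded_borel"
  using assms by (auto simp: bounded_borel_def intro!: boundedI)

lemma bounded_borelE:
  assumes "f \<in> bounded_borel"
  obtains B where "f \<in> borel_measurable borel" "\<And>x. \<bar>f x\<bar> \<le> B"
  using assms by (auto simp: bounded_borel_def bounded_iff)

lemma integrable_bounded_borel:
  assumes "f \<in> bounded_borel"
  shows "integrable (measure_of_prob \<gamma>) f"
proof -
  interpret prob_space "measure_of_prob \<gamma>" by (rule prob_space_measure_of_prob)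
  obtain B where "f \<in> borel_measurable borel" "\<And>x. \<bar>f x\<bar> \<le> B"
    using assms by (rule bounded_borelE) blast
  then show ?thesis by (intro integrable_const_bound[where B=B]) auto
qed

lemma exp_bounded_borel:
  assumes "f \<in> bounded_borel"
  shows "(\<lambda>x. exp (f x)) \<in> bounded_borel"
proof -
  obtain B where "f \<in> borel_measurable borel" "\<And>x. \<bar>f x\<bar> \<le> B"
    using assms by (rule bounded_borelE) blast
  then show ?thesis
    by (intro bounded_borelI[where B="exp B"]) (auto intro: order_trans[OF abs_ge_self])
qed

lemma integral_exp_pos:
  assumes "f \<in> bounded_borel"
  shows "(\<integral>x. exp (f x) \<partial>measure_of_prob \<gamma>) > 0"
proof -
  interpret prob_space "measure_of_prob \<gamma>" by (rule prob_space_measure_of_prob)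
  have i: "integrable (measure_of_prob \<gamma>) (\<lambda>x. exp (f x))"
    by (intro integrable_bounded_borel exp_bounded_borel assms)
  have "(\<integral>x. exp (f x) \<partial>measure_of_prob \<gamma>) \<noteq> 0"
    using integral_nonneg_eq_0_iff_AE[OF i] AE_False by simp
  then show ?thesis by (simp add: less_le)
qed

text \<open>For \<open>Q = H P\<close>, the inequality \<open>1 + z \<le> e\<^sup>z\<close> with \<open>z = b - ln H\<close> gives \<open>b + 1 \<le> ln H + e\<^sup>b / H\<close>
  wherever \<open>H > 0\<close>, that is \<open>Q\<close>-almost everywhere; integrating against \<open>Q\<close> turns \<open>e\<^sup>b / H\<close> into \<open>e\<^sup>b\<close>
  integrated against \<open>P\<close> over the set \<open>H > 0\<close>. It is used on a single coordinate, for the variational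
  formula, and on the \<open>N\<close>-fold product, for the lower bound.\<close>

lemma gibbs_inequality:
  fixes H b :: "'a \<Rightarrow> real"
  assumes P: "prob_space P" and Q: "prob_space Q" "Q = density P (\<lambda>x. ennreal (H x))"
    and H[measurable]: "H \<in> borel_measurable P" and H_nonneg: "\<And>x. 0 \<le> H x"
    and ln: "integrable Q (\<lambda>x. ln (H x))"
    and b[measurable]: "b \<in> borel_measurable P" and b_le: "\<And>x. \<bar>b x\<bar> \<le> B"
  shows "(\<integral>x. b x \<partial>Q) + 1 \<le> (\<integral>x. ln (H x) \<partial>Q) + (\<integral>x. exp (b x) \<partial>P)"
proof -
  interpret P: prob_space P by (rule P)
  interpret Q: prob_space Q by (rule Q)
  have [measurable_cong]: "sets Q = sets P" by (simp add: Q)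
  have exp_le: "exp (b x) \<le> exp B" for x using b_le[of x] by (auto simp: abs_le_iff)
  have int_b: "integrable Q b"
    using b_le by (intro Q.integrable_const_bound[where B=B]) auto
  have int_exp: "integrable P (\<lambda>x. exp (b x))"
    using exp_le by (intro P.integrable_const_bound[where B="exp B"]) auto
  have int_exp': "integrable P (\<lambda>x. H x *\<^sub>R (exp (b x) / H x))"
    by (rule Bochner_Integration.integrable_bound[OF int_exp]) (use H_nonneg in auto)
  have int_q: "integrable Q (\<lambda>x. exp (b x) / H x)"
    unfolding Q(2) by (subst integrable_density) (use int_exp' H_nonneg in auto)
  have "AE x in Q. 0 < H x"
    unfolding Q(2) by (subst AE_density) auto
  then have "AE x in Q. b x + 1 \<le> ln (H x) + exp (b x) / H x"
  proof eventually_elim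
    case (elim x)
    have "1 + (b x - ln (H x)) \<le> exp (b x - ln (H x))" by (rule exp_ge_add_one_self)
    also have "\<dots> = exp (b x) / H x" using elim by (simp add: exp_diff)
    finally show ?case by simp
  qed
  then have "(\<integral>x. b x + 1 \<partial>Q) \<le> (\<integral>x. ln (H x) + exp (b x) / H x \<partial>Q)"
    using int_b int_q ln by (intro integral_mono_AE) auto
  also have "\<dots> = (\<integral>x. ln (H x) \<partial>Q) + (\<integral>x. exp (b x) / H x \<partial>Q)"
    using int_q ln by simp
  also have "(\<integral>x. exp (b x) / H x \<partial>Q) = (\<integral>x. H x *\<^sub>R (exp (b x) / H x) \<partial>P)"
    unfolding Q(2) by (subst integral_density) (use H_nonneg in auto)
  also have "\<dots> \<le> (\<integral>x. exp (b x) \<partial>P)"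
    using H_nonneg int_exp int_exp' by (intro integral_mono) auto
  finally show ?thesis using int_b by (simp add: Q.prob_space)
qed

text \<open>The negative part of the log-density is integrable, because \<open>h (- ln h) \<le> 1\<close> for \<open>h > 0\<close>. Thus the
  difference of extended integrals that defines relative entropy is never \<open>\<infinity> - \<infinity>\<close>.\<close>

lemma nn_integral_neg_ln_density_le:
  fixes H :: "'a \<Rightarrow> real"
  assumes P: "prob_space P" and H[measurable]: "H \<in> borel_measurable P" and H_nonneg: "\<And>x. 0 \<le> H x"
  shows "(\<integral>\<^sup>+x. ennreal (- ln (H x)) \<partial>density P (\<lambda>x. ennreal (H x))) \<le> 1"
proof -
  interpret P: prob_space P by (rule P)
  have "(\<integral>\<^sup>+x. ennreal (- ln (H x)) \<partial>density P (\<lambda>x. ennreal (H x))) =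
      (\<integral>\<^sup>+x. ennreal (H x) * ennreal (- ln (H x)) \<partial>P)"
    by (rule nn_integral_density) auto
  also have "\<dots> \<le> (\<integral>\<^sup>+x. 1 \<partial>P)"
  proof (rule nn_integral_mono)
    fix x
    show "ennreal (H x) * ennreal (- ln (H x)) \<le> 1"
    proof (cases "H x = 0")
      case False
      then have pos: "H x > 0" using H_nonneg[of x] by simp
      have "ln (1 / H x) \<le> 1 / H x - 1" using pos by (intro ln_le_minus_one) simp
      then have "- ln (H x) \<le> 1 / H x" using pos by (simp add: ln_div)
      then have "H x * (- ln (H x)) \<le> 1" using pos by (simp add: field_simps)
      then show ?thesis using pos by (simp add: ennreal_mult'[symmetric] del: mult_minus_right)
    qed simp
  qed
  also have "\<dots> = 1" by (simp add: P.emeasure_space_1)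
  finally show ?thesis .
qed

lemma absolutely_continuous_density:
  fixes \<gamma> \<gamma>0 :: "'a::topological_space prob"
  defines "P \<equiv> measure_of_prob \<gamma>0" and "Q \<equiv> measure_of_prob \<gamma>"
  defines "H \<equiv> \<lambda>x. enn2real (RN_deriv P Q x)"
  assumes ac: "absolutely_continuous P Q"
  shows "Q = density P (\<lambda>x. ennreal (H x))"
proof -
  interpret P: prob_space P unfolding P_def by (rule prob_space_measure_of_prob)
  interpret Q: prob_space Q unfolding Q_def by (rule prob_space_measure_of_prob)
  have s: "sets Q = sets P" by (simp add: P_def Q_def)
  have "Q = density P (RN_deriv P Q)"
    using P.density_RN_deriv[OF ac s] by simp
  also have "\<dots> = density P (\<lambda>x. ennreal (H x))"
  proof (rule density_cong)
    have "AE x in P. RN_deriv P Q x \<noteq> \<infinity>"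
      by (rule P.RN_deriv_finite[OF Q.sigma_finite_measure_axioms ac s])
    then show "AE x in P. RN_deriv P Q x = ennreal (H x)"
      by eventually_elim (simp add: H_def less_top)
  qed (auto simp: H_def)
  finally show ?thesis .
qed

lemma finite_relative_entropyE:
  fixes \<gamma> \<gamma>0 :: "'a::topological_space prob"
  assumes fin: "relative_entropy \<gamma> \<gamma>0 < \<infinity>"
  obtains H where "H \<in> borel_measurable borel" "\<And>x. 0 \<le> H x"
    "measure_of_prob \<gamma> = density (measure_of_prob \<gamma>0) (\<lambda>x. ennreal (H x))"
    "integrable (measure_of_prob \<gamma>) (\<lambda>x. ln (H x))"
    "relative_entropy \<gamma> \<gamma>0 = ereal (\<integral>x. ln (H x) \<partial>measure_of_prob \<gamma>)"
proof -
  define P where "P = measure_of_prob \<gamma>0"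
  define Q where "Q = measure_of_prob \<gamma>"
  define H where "H x = enn2real (RN_deriv P Q x)" for x
  have ac: "absolutely_continuous P Q"
    using fin unfolding relative_entropy_def Let_def P_def Q_def by (auto split: if_splits)
  have R: "relative_entropy \<gamma> \<gamma>0 = enn2ereal (\<integral>\<^sup>+x. ennreal (ln (H x)) \<partial>Q)
      - enn2ereal (\<integral>\<^sup>+x. ennreal (- ln (H x)) \<partial>Q)"
    using ac by (simp add: relative_entropy_def Let_def P_def Q_def H_def)
  have Q: "Q = density P (\<lambda>x. ennreal (H x))"
    using absolutely_continuous_density[of \<gamma>0 \<gamma>] ac by (simp add: P_def Q_def H_def)
  have "H \<in> borel_measurable P" unfolding H_def by simp
  then have Hm[measurable]: "H \<in> borel_measurable borel" by (simp add: P_def)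
  have neg: "(\<integral>\<^sup>+x. ennreal (- ln (H x)) \<partial>Q) \<le> 1"
    unfolding Q by (rule nn_integral_neg_ln_density_le) (auto simp: P_def H_def prob_space_measure_of_prob)
  then have neg': "(\<integral>\<^sup>+x. ennreal (- ln (H x)) \<partial>Q) \<noteq> \<infinity>" by (auto simp: top_unique)
  have pos: "(\<integral>\<^sup>+x. ennreal (ln (H x)) \<partial>Q) \<noteq> \<infinity>"
  proof
    assume "(\<integral>\<^sup>+x. ennreal (ln (H x)) \<partial>Q) = \<infinity>"
    with R neg' fin show False
      by (cases "\<integral>\<^sup>+x. ennreal (- ln (H x)) \<partial>Q") (auto simp: enn2ereal_ennreal)
  qed
  have int: "integrable Q (\<lambda>x. ln (H x))"
    using pos neg' by (auto simp: real_integrable_def Q_def)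
  have "relative_entropy \<gamma> \<gamma>0 = ereal (\<integral>x. ln (H x) \<partial>Q)"
    unfolding R real_lebesgue_integral_def[OF int] using pos neg'
    by (cases "\<integral>\<^sup>+x. ennreal (ln (H x)) \<partial>Q"; cases "\<integral>\<^sup>+x. ennreal (- ln (H x)) \<partial>Q")
       (auto simp: enn2ereal_ennreal)
  then show ?thesis
    using Q int Hm by (intro that[of H]) (auto simp: P_def Q_def H_def)
qed

text \<open>One half of the Donsker--Varadhan formula: the Gibbs inequality for \<open>g\<close> shifted by the constant that
  makes \<open>e\<^sup>g\<close> a density.\<close>

lemma donsker_varadhan_le:
  fixes \<gamma> \<gamma>0 :: "'a::topological_space prob"
  assumes le: "relative_entropy \<gamma> \<gamma>0 \<le> ereal c" and g: "g \<in> bounded_borel"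
  shows "(\<integral>x. g x \<partial>measure_of_prob \<gamma>) \<le> c + ln (\<integral>x. exp (g x) \<partial>measure_of_prob \<gamma>0)"
proof -
  interpret P: prob_space "measure_of_prob \<gamma>0" by (rule prob_space_measure_of_prob)
  interpret Q: prob_space "measure_of_prob \<gamma>" by (rule prob_space_measure_of_prob)
  from le have "relative_entropy \<gamma> \<gamma>0 < \<infinity>" by (auto intro: le_less_trans)
  from finite_relative_entropyE[OF this] obtain H where H: "H \<in> borel_measurable borel" "\<And>x. 0 \<le> H x"
    "measure_of_prob \<gamma> = density (measure_of_prob \<gamma>0) (\<lambda>x. ennreal (H x))"
    "integrable (measure_of_prob \<gamma>) (\<lambda>x. ln (H x))"
    "relative_entropy \<gamma> \<gamma>0 = ereal (\<integral>x. ln (H x) \<partial>measure_of_prob \<gamma>)" by metis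
  define Z where "Z = (\<integral>x. exp (g x) \<partial>measure_of_prob \<gamma>0)"
  have Z: "Z > 0" unfolding Z_def by (rule integral_exp_pos[OF g])
  obtain B where B: "g \<in> borel_measurable borel" "\<And>x. \<bar>g x\<bar> \<le> B"
    using g by (rule bounded_borelE) blast
  have "(\<integral>x. g x - ln Z \<partial>measure_of_prob \<gamma>) + 1 \<le>
      (\<integral>x. ln (H x) \<partial>measure_of_prob \<gamma>) + (\<integral>x. exp (g x - ln Z) \<partial>measure_of_prob \<gamma>0)"
  proof (rule gibbs_inequality[where B = "B + \<bar>ln Z\<bar>"])
    show "\<bar>g x - ln Z\<bar> \<le> B + \<bar>ln Z\<bar>" for x using B(2)[of x] by linarith
  qed (use H(1,2,4) B(1) in \<open>simp_all add: P.prob_space_axioms Q.prob_space_axioms H(3)[symmetric]\<close>)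
  also have "(\<integral>x. exp (g x - ln Z) \<partial>measure_of_prob \<gamma>0) = 1"
    using Z by (simp add: exp_diff Z_def)
  also have "(\<integral>x. g x - ln Z \<partial>measure_of_prob \<gamma>) = (\<integral>x. g x \<partial>measure_of_prob \<gamma>) - ln Z"
    using integrable_bounded_borel[OF g] by (simp add: Q.prob_space)
  finally show ?thesis using le H(5) by (simp add: Z_def)
qed

text \<open>Testing with \<open>t\<close> times the indicator of a null set bounds \<open>t\<close> times its \<open>\<gamma>\<close>-measure by \<open>c\<close> for
  every \<open>t\<close>.\<close>

lemma donsker_varadhan_absolutely_continuous:
  fixes \<gamma> \<gamma>0 :: "'a::topological_space prob"
  assumes dv: "\<And>g. g \<in> bounded_borel \<Longrightarrow>
    (\<integral>x. g x \<partial>measure_of_prob \<gamma>) \<le> c + ln (\<integral>x. exp (g x) \<partial>measure_of_prob \<gamma>0)"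
  shows "absolutely_continuous (measure_of_prob \<gamma>0) (measure_of_prob \<gamma>)"
  unfolding absolutely_continuous_def
proof
  interpret P: prob_space "measure_of_prob \<gamma>0" by (rule prob_space_measure_of_prob)
  interpret Q: prob_space "measure_of_prob \<gamma>" by (rule prob_space_measure_of_prob)
  fix A assume A: "A \<in> null_sets (measure_of_prob \<gamma>0)"
  then have [measurable]: "A \<in> sets borel" by (auto simp: null_sets_def)
  have *: "t * measure (measure_of_prob \<gamma>) A \<le> c" for t
  proof -
    have "(\<lambda>x. t * indicator A x) \<in> bounded_borel"
      by (rule bounded_borelI[where B="\<bar>t\<bar>"]) (auto simp: indicator_def)
    from dv[OF this] have "(\<integral>x. t * indicator A x \<partial>measure_of_prob \<gamma>) \<le>
        c + ln (\<integral>x. exp (t * indicator A x) \<partial>measure_of_prob \<gamma>0)" .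
    also have "(\<integral>x. exp (t * indicator A x) \<partial>measure_of_prob \<gamma>0) = (\<integral>x. 1 \<partial>measure_of_prob \<gamma>0)"
    proof (rule integral_cong_AE)
      show "AE x in measure_of_prob \<gamma>0. exp (t * indicator A x) = 1"
        using AE_not_in[OF A] by eventually_elim simp
    qed auto
    finally show ?thesis by (simp add: P.prob_space)
  qed
  have "measure (measure_of_prob \<gamma>) A = 0"
  proof (rule ccontr)
    assume "measure (measure_of_prob \<gamma>) A \<noteq> 0"
    with *[of "(\<bar>c\<bar> + 1) / measure (measure_of_prob \<gamma>) A"] show False by simp
  qed
  then show "A \<in> null_sets (measure_of_prob \<gamma>)"
    by (auto simp: null_sets_def Q.emeasure_eq_measure)
qed

text \<open>The other half of the formula: test with the log-density cut off at \<open>\<plusminus>n\<close> and let \<open>n\<close> tend to infinity.\<close>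

lemma relative_entropy_leI:
  fixes \<gamma> \<gamma>0 :: "'a::topological_space prob"
  assumes dv: "\<And>g. g \<in> bounded_borel \<Longrightarrow>
    (\<integral>x. g x \<partial>measure_of_prob \<gamma>) \<le> c + ln (\<integral>x. exp (g x) \<partial>measure_of_prob \<gamma>0)"
  shows "relative_entropy \<gamma> \<gamma>0 \<le> ereal c"
proof -
  define P where "P = measure_of_prob \<gamma>0"
  define Q where "Q = measure_of_prob \<gamma>"
  define H where "H x = enn2real (RN_deriv P Q x)" for x
  interpret P: prob_space P unfolding P_def by (rule prob_space_measure_of_prob)
  interpret Q: prob_space Q unfolding Q_def by (rule prob_space_measure_of_prob)
  have ac: "absolutely_continuous P Q"
    unfolding P_def Q_def by (rule donsker_varadhan_absolutely_continuous[OF dv])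
  have R: "relative_entropy \<gamma> \<gamma>0 = enn2ereal (\<integral>\<^sup>+x. ennreal (ln (H x)) \<partial>Q)
      - enn2ereal (\<integral>\<^sup>+x. ennreal (- ln (H x)) \<partial>Q)"
    using ac by (simp add: relative_entropy_def Let_def P_def Q_def H_def)
  have Q: "Q = density P (\<lambda>x. ennreal (H x))"
    using absolutely_continuous_density[of \<gamma>0 \<gamma>] ac by (simp add: P_def Q_def H_def)
  have "H \<in> borel_measurable P" unfolding H_def by simp
  then have Hm[measurable]: "H \<in> borel_measurable borel" by (simp add: P_def)
  have [measurable_cong]: "sets P = sets borel" "sets Q = sets borel" by (simp_all add: P_def Q_def)
  have H_nonneg: "0 \<le> H x" for x by (simp add: H_def)
  have "(\<integral>\<^sup>+x. ennreal (- ln (H x)) \<partial>Q) \<le> 1"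
    unfolding Q by (rule nn_integral_neg_ln_density_le) (auto simp: H_nonneg P.prob_space_axioms)
  then have neg: "(\<integral>\<^sup>+x. ennreal (- ln (H x)) \<partial>Q) < \<infinity>" using ennreal_one_less_top by (auto intro: le_less_trans)
  define b where "b = (\<integral>x. max 0 (- ln (H x)) \<partial>Q)"
  have int_neg: "integrable Q (\<lambda>x. max 0 (- ln (H x)))"
    using neg by (intro integrableI_nonneg) (auto simp: ennreal_max_0' max.commute)
  have b: "b \<ge> 0" "(\<integral>\<^sup>+x. ennreal (- ln (H x)) \<partial>Q) = ennreal b"
    using nn_integral_eq_integral[OF int_neg] by (auto simp: b_def)
  have "(\<lambda>x. 0) \<in> bounded_borel" by (rule bounded_borelI[where B=0]) auto
  from dv[OF this] have c: "0 \<le> c" by (simp add: P.prob_space[unfolded P_def])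
  have int_H: "integrable P H" "(\<integral>x. H x \<partial>P) = 1"
  proof -
    have "(\<integral>\<^sup>+x. ennreal (H x) \<partial>P) = emeasure Q (space Q)"
      by (subst Q, subst emeasure_density) (auto simp: Q_def P_def)
    then have "(\<integral>\<^sup>+x. ennreal (H x) \<partial>P) = ennreal 1" by (simp add: Q.emeasure_space_1)
    then show "integrable P H" "(\<integral>x. H x \<partial>P) = 1"
      using H_nonneg nn_integral_eq_integrable[of H P 1] by auto
  qed
  have AE_pos: "AE x in Q. 0 < H x"
    unfolding Q by (subst AE_density) auto
  have approx: "(\<integral>\<^sup>+x. ennreal (min (real n) (ln (H x))) \<partial>Q) \<le> ennreal (c + b + exp (- real n))" for n
  proof -
    \<comment> \<open>The value on \<open>H = 0\<close> has to be set by hand since \<open>ln 0 = 0\<close>; with it, \<open>exp g \<le> H + exp (- n)\<close>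
      everywhere, so that the exponential integral exceeds 1 by at most \<open>exp (- n)\<close>.\<close>
    define g where "g x = (if H x = 0 then - real n else max (- real n) (min (real n) (ln (H x))))" for x
    have g: "g \<in> bounded_borel"
    proof (rule bounded_borelI[where B="real n"])
      have "\<bar>max (- r) (min r y)\<bar> \<le> r" if "0 \<le> r" for r y :: real
        using that by (auto simp: max_def min_def)
      then show "\<bar>g x\<bar> \<le> real n" for x by (simp add: g_def)
      show "g \<in> borel_measurable borel" unfolding g_def by measurable
    qed
    then have gm[measurable]: "g \<in> borel_measurable borel" by (auto simp: bounded_borel_def)
    have "(\<integral>x. exp (g x) \<partial>P) \<le> (\<integral>x. H x + exp (- real n) \<partial>P)"
    proof (rule integral_mono)
      show "integrable P (\<lambda>x. exp (g x))"
        unfolding P_def by (intro integrable_bounded_borel exp_bounded_borel g)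
      show "exp (g x) \<le> H x + exp (- real n)" for x
      proof (cases "H x = 0 \<or> ln (H x) \<le> - real n")
        case True
        then have "g x = - real n" by (auto simp: g_def)
        then show ?thesis using H_nonneg[of x] by simp
      next
        case False
        then have "g x \<le> ln (H x)" "H x > 0" using H_nonneg[of x] by (auto simp: g_def)
        then have "exp (g x) \<le> H x" by (metis exp_le_cancel_iff exp_ln)
        then show ?thesis by (simp add: add_increasing2)
      qed
    qed (use int_H in auto)
    also have "\<dots> = 1 + exp (- real n)" using int_H by (simp add: P.prob_space)
    finally have "ln (\<integral>x. exp (g x) \<partial>P) \<le> ln (1 + exp (- real n))"
      using integral_exp_pos[OF g, of \<gamma>0] unfolding P_def
      by (subst ln_le_cancel_iff) (auto intro: add_pos_pos)
    also have "\<dots> \<le> exp (- real n)" by (rule ln_add_one_self_le_self) simp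
    finally have dv': "(\<integral>x. g x \<partial>Q) \<le> c + exp (- real n)"
      using dv[OF g] by (simp add: P_def Q_def)
    have int_pos: "integrable Q (\<lambda>x. max 0 (min (real n) (ln (H x))))"
      unfolding Q_def
    proof (intro integrable_bounded_borel bounded_borelI[where B="real n"])
      have clip: "\<bar>max 0 (min r y)\<bar> \<le> r" if "0 \<le> r" for r y :: real
        using that by (auto simp: max_def min_def)
      show "\<bar>max 0 (min (real n) (ln (H x)))\<bar> \<le> real n" for x by (rule clip) simp
    qed simp
    have "AE x in Q. max 0 (min (real n) (ln (H x))) \<le> g x + max 0 (- ln (H x))"
      using AE_pos
    proof eventually_elim
      case (elim x)
      have "max 0 (min r y) \<le> max (- r) (min r y) + max 0 (- y)" if "0 \<le> r" for r y :: real
        using that by (auto simp: max_def min_def)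
      from this[of "real n" "ln (H x)"] show ?case using elim by (simp add: g_def)
    qed
    then have "(\<integral>x. max 0 (min (real n) (ln (H x))) \<partial>Q) \<le> (\<integral>x. g x + max 0 (- ln (H x)) \<partial>Q)"
      using int_pos int_neg integrable_bounded_borel[OF g, of \<gamma>]
      by (intro integral_mono_AE) (auto simp: Q_def)
    also have "\<dots> = (\<integral>x. g x \<partial>Q) + b"
      using int_neg integrable_bounded_borel[OF g, of \<gamma>] by (simp add: Q_def b_def)
    finally have le: "(\<integral>x. max 0 (min (real n) (ln (H x))) \<partial>Q) \<le> c + b + exp (- real n)"
      using dv' by simp
    have "(\<integral>\<^sup>+x. ennreal (min (real n) (ln (H x))) \<partial>Q) =
        (\<integral>\<^sup>+x. ennreal (max 0 (min (real n) (ln (H x)))) \<partial>Q)"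
      by (simp add: ennreal_max_0')
    also have "\<dots> = ennreal (\<integral>x. max 0 (min (real n) (ln (H x))) \<partial>Q)"
      by (rule nn_integral_eq_integral[OF int_pos]) simp
    finally show ?thesis using le by (simp add: ennreal_leI)
  qed
  have "(\<lambda>n. \<integral>\<^sup>+x. ennreal (min (real n) (ln (H x))) \<partial>Q) \<longlonglongrightarrow> (\<integral>\<^sup>+x. ennreal (ln (H x)) \<partial>Q)"
  proof (rule nn_integral_LIMSEQ)
    show "incseq (\<lambda>n x. ennreal (min (real n) (ln (H x))))"
      by (auto simp: incseq_def le_fun_def intro!: ennreal_leI)
    show "(\<lambda>n. ennreal (min (real n) (ln (H x)))) \<longlonglongrightarrow> ennreal (ln (H x))" for x
    proof -
      obtain m :: nat where "ln (H x) \<le> real m" using real_arch_simple by blast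
      then have "\<forall>n\<ge>m. ennreal (min (real n) (ln (H x))) = ennreal (ln (H x))" by (auto simp: min_def)
      then show ?thesis
        by (intro tendsto_eventually) (use eventually_sequentially in blast)
    qed
  qed auto
  moreover have "(\<lambda>n. ennreal (c + b + exp (- real n))) \<longlonglongrightarrow> ennreal (c + b + 0)"
  proof (intro tendsto_ennrealI tendsto_add tendsto_const)
    show "(\<lambda>n. exp (- real n)) \<longlonglongrightarrow> 0"
      by (intro filterlim_compose[OF exp_at_bot] filterlim_compose[OF filterlim_uminus_at_bot_at_top] filterlim_real_sequentially)
  qed
  ultimately have le: "(\<integral>\<^sup>+x. ennreal (ln (H x)) \<partial>Q) \<le> ennreal (c + b)"
    using approx by (intro LIMSEQ_le) auto
  then obtain r where r: "(\<integral>\<^sup>+x. ennreal (ln (H x)) \<partial>Q) = ennreal r" "0 \<le> r"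
    by (cases "\<integral>\<^sup>+x. ennreal (ln (H x)) \<partial>Q") (auto simp: top_unique)
  have "r \<le> c + b" using le b(1) c unfolding r(1) by (subst (asm) ennreal_le_iff) auto
  then show ?thesis
    unfolding R b(2) r(1) using b(1) r(2) by (simp add: enn2ereal_ennreal)
qed

section \<open>Finitely additive means and compactness\<close>

text \<open>The value 0 outside the bounded Borel functions makes \<open>expect \<gamma>\<close> a point of a product of compact
  intervals.\<close>

definition expect :: "'a::topological_space prob \<Rightarrow> ('a \<Rightarrow> real) \<Rightarrow> real" where
  "expect \<gamma> f = (if f \<in> bounded_borel then \<integral>x. f x \<partial>measure_of_prob \<gamma> else 0)"

text \<open>Positive normalised linear functionals on the bounded Borel functions, equivalently finitely additive
  probabilities on the Borel sets. They compactify the space of probability measures for the topology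
  of pointwise convergence on bounded Borel functions, which is finer than the weak topology.\<close>

definition means :: "(('a::topological_space \<Rightarrow> real) \<Rightarrow> real) set" where
  "means = {\<Lambda>. (\<forall>f. f \<notin> bounded_borel \<longrightarrow> \<Lambda> f = 0) \<and>
     (\<forall>f g. f \<in> bounded_borel \<longrightarrow> g \<in> bounded_borel \<longrightarrow> \<Lambda> (\<lambda>x. f x + g x) = \<Lambda> f + \<Lambda> g) \<and>
     (\<forall>c f. f \<in> bounded_borel \<longrightarrow> \<Lambda> (\<lambda>x. c * f x) = c * \<Lambda> f) \<and>
     (\<forall>f. f \<in> bounded_borel \<and> (\<forall>x. 0 \<le> f x) \<longrightarrow> 0 \<le> \<Lambda> f) \<and>
     \<Lambda> (\<lambda>_. 1) = 1}"

lemma bounded_borel_const: "(\<lambda>_. c) \<in> bounded_borel"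
  by (rule bounded_borelI[where B="\<bar>c\<bar>"]) auto

lemma bounded_borel_indicator: "A \<in> sets borel \<Longrightarrow> indicator A \<in> bounded_borel"
  by (rule bounded_borelI[where B=1]) (auto simp: indicator_def)

lemma bounded_borel_cmult:
  assumes "f \<in> bounded_borel" shows "(\<lambda>x. c * f x) \<in> bounded_borel"
proof -
  obtain B where B: "f \<in> borel_measurable borel" "\<And>x. \<bar>f x\<bar> \<le> B"
    using assms by (rule bounded_borelE) blast
  show ?thesis
    by (rule bounded_borelI[where B="\<bar>c\<bar> * B"]) (use B in \<open>auto simp: abs_mult intro: mult_left_mono\<close>)
qed

lemma bounded_borel_add:
  assumes "f \<in> bounded_borel" "g \<in> bounded_borel" shows "(\<lambda>x. f x + g x) \<in> bounded_borel"
proof -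
  obtain B where B: "f \<in> borel_measurable borel" "\<And>x. \<bar>f x\<bar> \<le> B"
    using assms(1) by (rule bounded_borelE) blast
  obtain C where C: "g \<in> borel_measurable borel" "\<And>x. \<bar>g x\<bar> \<le> C"
    using assms(2) by (rule bounded_borelE) blast
  show ?thesis
  proof (rule bounded_borelI[where B="B + C"])
    show "\<bar>f x + g x\<bar> \<le> B + C" for x using B(2)[of x] C(2)[of x] by linarith
  qed (use B C in auto)
qed

lemma bounded_borel_continuous:
  "continuous_on UNIV f \<Longrightarrow> bounded (range f) \<Longrightarrow> f \<in> bounded_borel"
  by (simp add: bounded_borel_def borel_measurable_continuous_onI)

lemma expect_in_means: "expect \<gamma> \<in> means"
proof -
  interpret prob_space "measure_of_prob \<gamma>" by (rule prob_space_measure_of_prob)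
  show ?thesis
    by (auto simp: means_def expect_def bounded_borel_add bounded_borel_cmult bounded_borel_const
        integrable_bounded_borel prob_space)
qed

lemma mean_add: "\<Lambda> \<in> means \<Longrightarrow> f \<in> bounded_borel \<Longrightarrow> g \<in> bounded_borel \<Longrightarrow> \<Lambda> (\<lambda>x. f x + g x) = \<Lambda> f + \<Lambda> g"
  and mean_cmult: "\<Lambda> \<in> means \<Longrightarrow> f \<in> bounded_borel \<Longrightarrow> \<Lambda> (\<lambda>x. c * f x) = c * \<Lambda> f"
  and mean_nonneg: "\<Lambda> \<in> means \<Longrightarrow> f \<in> bounded_borel \<Longrightarrow> (\<And>x. 0 \<le> f x) \<Longrightarrow> 0 \<le> \<Lambda> f"
  and mean_one: "\<Lambda> \<in> means \<Longrightarrow> \<Lambda> (\<lambda>_. 1) = 1"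
  and mean_outside: "\<Lambda> \<in> means \<Longrightarrow> f \<notin> bounded_borel \<Longrightarrow> \<Lambda> f = 0"
  by (auto simp: means_def)

lemma mean_le:
  assumes L: "\<Lambda> \<in> means" and f: "f \<in> bounded_borel" and g: "g \<in> bounded_borel"
    and le: "\<And>x. f x \<le> g x + B"
  shows "\<Lambda> f \<le> \<Lambda> g + B"
proof -
  have 1: "(\<lambda>x. (-1) * f x) \<in> bounded_borel" "(\<lambda>x. B * 1) \<in> bounded_borel"
    by (rule bounded_borel_cmult[OF f], rule bounded_borel_const)
  have "0 \<le> \<Lambda> (\<lambda>x. (g x + B * 1) + (-1) * f x)"
    using le by (intro mean_nonneg[OF L] bounded_borel_add 1 g) (simp add: algebra_simps)
  also have "\<dots> = \<Lambda> g + B * \<Lambda> (\<lambda>_. 1) + (-1) * \<Lambda> f"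
    unfolding mean_add[OF L bounded_borel_add[OF g 1(2)] 1(1)] mean_add[OF L g 1(2)]
      mean_cmult[OF L f] mean_cmult[OF L bounded_borel_const] ..
  finally show ?thesis using mean_one[OF L] by simp
qed

lemma mean_sum:
  assumes L: "\<Lambda> \<in> means" and "finite J" and "\<And>j. j \<in> J \<Longrightarrow> f j \<in> bounded_borel"
  shows "(\<lambda>x. \<Sum>j\<in>J. f j x) \<in> bounded_borel \<and> \<Lambda> (\<lambda>x. \<Sum>j\<in>J. f j x) = (\<Sum>j\<in>J. \<Lambda> (f j))"
  using assms(2,3)
proof (induction J)
  case empty
  show ?case using mean_cmult[OF L bounded_borel_const, of 0 1] by (simp add: bounded_borel_const)
next
  case (insert j J)
  then show ?case by (simp add: bounded_borel_add mean_add[OF L])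
qed

lemma mean_abs_le:
  assumes L: "\<Lambda> \<in> means" and f: "f \<in> bounded_borel" and le: "\<And>x. \<bar>f x\<bar> \<le> B"
  shows "\<bar>\<Lambda> f\<bar> \<le> B"
proof -
  have z: "\<Lambda> (\<lambda>_. 0) = 0" using mean_cmult[OF L bounded_borel_const, of 0 1] by simp
  have "\<Lambda> f \<le> \<Lambda> (\<lambda>_. 0) + B" "\<Lambda> (\<lambda>_. 0) \<le> \<Lambda> f + B"
  proof -
    have *: "f x \<le> 0 + B" "0 \<le> f x + B" for x using le[of x] by linarith+
    show "\<Lambda> f \<le> \<Lambda> (\<lambda>_. 0) + B" by (rule mean_le[OF L f bounded_borel_const *(1)])
    show "\<Lambda> (\<lambda>_. 0) \<le> \<Lambda> f + B" by (rule mean_le[OF L bounded_borel_const f *(2)])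
  qed
  then show ?thesis using z by simp
qed

text \<open>A bounded Borel function is within \<open>1 / n\<close> of the step function \<open>\<lfloor>n f\<rfloor> / n\<close>, which takes finitely many
  values, so a mean is determined by its values on indicators.\<close>

lemma mean_eqI:
  fixes \<Lambda> \<Lambda>' :: "('a::topological_space \<Rightarrow> real) \<Rightarrow> real"
  assumes L: "\<Lambda> \<in> means" and L': "\<Lambda>' \<in> means"
    and eq: "\<And>A. A \<in> sets borel \<Longrightarrow> \<Lambda> (indicator A) = \<Lambda>' (indicator A)"
  shows "\<Lambda> = \<Lambda>'"
proof
  fix f :: "'a \<Rightarrow> real"
  show "\<Lambda> f = \<Lambda>' f"
  proof (cases "f \<in> bounded_borel")
    case True
    then obtain B where B: "f \<in> borel_measurable borel" "\<And>x. \<bar>f x\<bar> \<le> B"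
      by (rule bounded_borelE) blast
    note [measurable] = B(1)
    have "\<bar>\<Lambda> f - \<Lambda>' f\<bar> \<le> 2 / real n" if n: "n > 0" for n :: nat
    proof -
      define J where "J = {\<lfloor>- (real n * B)\<rfloor>..\<lfloor>real n * B\<rfloor>}"
      define u where "u j x = (of_int j / real n) * indicator {x. \<lfloor>real n * f x\<rfloor> = j} x" for j x
      define s where "s x = (\<Sum>j\<in>J. u j x)" for x
      have J: "\<lfloor>real n * f x\<rfloor> \<in> J" for x
      proof -
        have "- B \<le> f x" "f x \<le> B" using B(2)[of x] by auto
        then have "- (real n * B) \<le> real n * f x" "real n * f x \<le> real n * B"
          using mult_left_mono[of "- B" "f x" "real n"] mult_left_mono[of "f x" B "real n"] by auto
        then show ?thesis unfolding J_def by (auto intro!: floor_mono)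
      qed
      have s: "s x = of_int \<lfloor>real n * f x\<rfloor> / real n" for x
      proof -
        have "s x = (\<Sum>j\<in>J. if \<lfloor>real n * f x\<rfloor> = j then of_int j / real n else 0)"
          unfolding s_def u_def by (intro sum.cong) (auto simp: indicator_def)
        also have "\<dots> = of_int \<lfloor>real n * f x\<rfloor> / real n"
          using J by (simp add: J_def)
        finally show ?thesis .
      qed
      have sets: "{x. \<lfloor>real n * f x\<rfloor> = j} \<in> sets borel" for j by measurable
      have summand: "u j \<in> bounded_borel" for j
        unfolding u_def by (intro bounded_borel_cmult bounded_borel_indicator sets)
      have fin: "finite J" by (simp add: J_def)
      have s_bb: "s \<in> bounded_borel" unfolding s_def[abs_def] by (rule mean_sum[OF L fin summand, THEN conjunct1])
      have "\<Lambda> s = \<Lambda>' s"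
        unfolding s_def[abs_def] mean_sum[OF L fin summand, THEN conjunct2] mean_sum[OF L' fin summand, THEN conjunct2]
        unfolding u_def
        by (intro sum.cong refl)
           (simp only: mean_cmult[OF L bounded_borel_indicator[OF sets]] mean_cmult[OF L' bounded_borel_indicator[OF sets]] eq[OF sets])
      have 1: "s x \<le> f x + 0" "f x \<le> s x + 1 / real n" for x
      proof -
        have "of_int \<lfloor>real n * f x\<rfloor> \<le> real n * f x" "real n * f x \<le> of_int \<lfloor>real n * f x\<rfloor> + 1"
          by linarith+
        then show "s x \<le> f x + 0" "f x \<le> s x + 1 / real n"
          unfolding s using n by (auto simp: field_simps)
      qed
      have "\<Lambda> s \<le> \<Lambda> f" "\<Lambda> f \<le> \<Lambda> s + 1 / real n" "\<Lambda>' s \<le> \<Lambda>' f" "\<Lambda>' f \<le> \<Lambda>' s + 1 / real n"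
        using mean_le[OF L s_bb True 1(1)] mean_le[OF L True s_bb 1(2)]
              mean_le[OF L' s_bb True 1(1)] mean_le[OF L' True s_bb 1(2)] by auto
      then have "\<bar>\<Lambda> f - \<Lambda>' f\<bar> \<le> 1 / real n" using \<open>\<Lambda> s = \<Lambda>' s\<close> by linarith
      also have "\<dots> \<le> 2 / real n" by (simp add: divide_right_mono)
      finally show ?thesis .
    qed
    then have "\<bar>\<Lambda> f - \<Lambda>' f\<bar> \<le> 0"
      by (intro LIMSEQ_le_const[OF lim_const_over_n[of 2]] exI[of _ 1]) auto
    then show ?thesis by simp
  next
    case False
    then show ?thesis using L L' by (simp add: mean_outside)
  qed
qed

text \<open>By Tychonoff: the means form a closed subset of the product of the intervals bounded by the sup norms.\<close>

lemma compact_means: "compact (means :: (('a::topological_space \<Rightarrow> real) \<Rightarrow> real) set)"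
proof -
  define b where "b f = (if f \<in> bounded_borel then SUP x. \<bar>f x\<bar> else 0)" for f :: "'a \<Rightarrow> real"
  have "compactin (product_topology (\<lambda>_. euclidean) UNIV) (PiE UNIV (\<lambda>f. {- b f..b f}))"
    by (simp add: compactin_PiE)
  then have comp: "compact (PiE UNIV (\<lambda>f. {- b f..b f}))"
    by (simp add: euclidean_product_topology)
  have cont: "continuous_on UNIV (\<lambda>\<Lambda>::('a \<Rightarrow> real) \<Rightarrow> real. \<Lambda> f)" for f by simp
  have cl: "closed (means :: (('a \<Rightarrow> real) \<Rightarrow> real) set)"
  proof -
    have "closed {\<Lambda>::('a \<Rightarrow> real) \<Rightarrow> real. P \<longrightarrow> \<Lambda> f = c}" for P f c
      by (cases P) (simp_all add: closed_Collect_eq[OF cont continuous_on_const])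
    moreover have "closed {\<Lambda>::('a \<Rightarrow> real) \<Rightarrow> real. P \<longrightarrow> Q \<longrightarrow> \<Lambda> h = \<Lambda> f + \<Lambda> g}" for P Q f g h
      by (cases P; cases Q) (simp_all add: closed_Collect_eq[OF cont continuous_on_add[OF cont cont]])
    moreover have "closed {\<Lambda>::('a \<Rightarrow> real) \<Rightarrow> real. P \<longrightarrow> \<Lambda> h = c * \<Lambda> f}" for P c f h
      by (cases P) (simp_all add: closed_Collect_eq[OF cont continuous_on_mult[OF continuous_on_const cont]])
    moreover have "closed {\<Lambda>::('a \<Rightarrow> real) \<Rightarrow> real. P \<longrightarrow> 0 \<le> \<Lambda> f}" for P f
      by (cases P) (simp_all add: closed_Collect_le[OF continuous_on_const cont])
    moreover have "closed {\<Lambda>::('a \<Rightarrow> real) \<Rightarrow> real. \<Lambda> f = 1}" for f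
      by (rule closed_Collect_eq[OF cont continuous_on_const])
    ultimately show ?thesis
      unfolding means_def by (intro closed_Collect_conj closed_Collect_all)
  qed
  have "means \<subseteq> PiE UNIV (\<lambda>f. {- b f..b f})"
  proof (intro subsetI PiE_I)
    fix \<Lambda> :: "('a \<Rightarrow> real) \<Rightarrow> real" and f :: "'a \<Rightarrow> real"
    assume L: "\<Lambda> \<in> means"
    show "\<Lambda> f \<in> {- b f..b f}"
    proof (cases "f \<in> bounded_borel")
      case True
      then obtain B where B: "\<And>x. \<bar>f x\<bar> \<le> B" by (rule bounded_borelE) blast
      have "\<bar>f x\<bar> \<le> b f" for x
        using True B by (auto simp: b_def intro!: cSUP_upper bdd_aboveI2[where M=B])
      from mean_abs_le[OF L True this] show ?thesis by (simp add: abs_le_iff)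
    next
      case False
      then show ?thesis using mean_outside[OF L] by (simp add: b_def)
    qed
  qed auto
  then have "means = PiE UNIV (\<lambda>f. {- b f..b f}) \<inter> means" by blast
  then show ?thesis using compact_Int_closed[OF comp cl] by simp
qed

lemma inj_expect: "inj expect"
proof (rule injI)
  fix \<gamma> \<gamma>' :: "'a::topological_space prob"
  assume eq: "expect \<gamma> = expect \<gamma>'"
  interpret G: prob_space "measure_of_prob \<gamma>" by (rule prob_space_measure_of_prob)
  interpret G': prob_space "measure_of_prob \<gamma>'" by (rule prob_space_measure_of_prob)
  show "\<gamma> = \<gamma>'"
  proof (intro prob_eqI measure_eqI)
    fix A assume "A \<in> sets (measure_of_prob \<gamma>)"
    then have A: "A \<in> sets borel" by simp
    show "emeasure (measure_of_prob \<gamma>) A = emeasure (measure_of_prob \<gamma>') A"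
      using fun_cong[OF eq, of "indicator A"] bounded_borel_indicator[OF A] A
      by (simp add: expect_def G.emeasure_eq_measure G'.emeasure_eq_measure)
  qed simp
qed

text \<open>The weak topology is generated by coordinates of \<open>expect\<close> at bounded continuous functions, hence is
  coarser than the topology pulled back from the product.\<close>

lemma open_prob_expect:
  fixes U :: "'a::topological_space prob set"
  assumes "open U"
  shows "\<exists>V. open V \<and> U = expect -` V"
  using assms unfolding open_prob_def
proof (induction rule: generate_topology.induct)
  case UNIV
  then show ?case by (intro exI[of _ UNIV]) auto
next
  case (Int a b)
  then obtain V W where "open V" "a = expect -` V" "open W" "b = expect -` W" by blast
  then show ?case by (intro exI[of _ "V \<inter> W"]) auto
next
  case (UN K)
  then obtain V where "\<And>k. k \<in> K \<Longrightarrow> open (V k) \<and> k = expect -` V k" by metis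
  then show ?case by (intro exI[of _ "\<Union>k\<in>K. V k"]) auto
next
  case (Basis s)
  then obtain f :: "'a \<Rightarrow> real" and V where
    s: "s = {\<mu>. (\<integral>x. f x \<partial>measure_of_prob \<mu>) \<in> V}"
    and f: "continuous_on UNIV f" "bounded (range f)" "open V" by blast
  have "open {\<Lambda>::('a \<Rightarrow> real) \<Rightarrow> real. \<Lambda> f \<in> V}"
    using open_vimage[OF f(3) continuous_on_product_coordinates[of f]] by (simp add: vimage_def)
  then show ?case
    using bounded_borel_continuous[OF f(1,2)]
    by (intro exI[of _ "{\<Lambda>. \<Lambda> f \<in> V}"]) (auto simp: s expect_def)
qed

text \<open>The means that satisfy the constraints of the variational formula at level \<open>c\<close>. All of these turn
  out to be genuine measures, which is what makes entropy sublevels compact.\<close>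

definition entropic_means :: "'a::topological_space prob \<Rightarrow> real \<Rightarrow> (('a \<Rightarrow> real) \<Rightarrow> real) set" where
  "entropic_means \<gamma>0 c = {\<Lambda> \<in> means. \<forall>g\<in>bounded_borel.
     \<Lambda> g \<le> c + ln (\<integral>x. exp (g x) \<partial>measure_of_prob \<gamma>0)}"

lemma expect_entropic_iff:
  "expect \<gamma> \<in> entropic_means \<gamma>0 c \<longleftrightarrow> relative_entropy \<gamma> \<gamma>0 \<le> ereal c"
proof
  assume "expect \<gamma> \<in> entropic_means \<gamma>0 c"
  then show "relative_entropy \<gamma> \<gamma>0 \<le> ereal c"
    by (intro relative_entropy_leI) (auto simp: entropic_means_def expect_def)
next
  assume "relative_entropy \<gamma> \<gamma>0 \<le> ereal c"
  then show "expect \<gamma> \<in> entropic_means \<gamma>0 c"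
    using donsker_varadhan_le by (auto simp: entropic_means_def expect_def expect_in_means)
qed

text \<open>The reason why an entropy bound rules out merely finitely additive means: the constraint for
  \<open>t 1\<^bsub>A\<^esub>\<close> reads \<open>t \<Lambda>(1\<^bsub>A\<^esub>) \<le> c + ln (1 + (e\<^sup>t - 1) \<gamma>0(A))\<close>, and along \<open>A\<close> decreasing to the empty
  set the right-hand side tends to \<open>c\<close>, for arbitrarily large \<open>t\<close>.\<close>

lemma entropic_mean_continuous_at_empty:
  fixes \<gamma>0 :: "'a::topological_space prob"
  assumes L: "\<Lambda> \<in> entropic_means \<gamma>0 c"
    and A: "\<And>i. A i \<in> sets borel" "decseq A" "(\<Inter>i. A i) = {}"
  shows "(\<lambda>i. \<Lambda> (indicator (A i))) \<longlonglongrightarrow> 0"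
proof (rule LIMSEQ_I)
  interpret P: prob_space "measure_of_prob \<gamma>0" by (rule prob_space_measure_of_prob)
  fix r :: real assume r: "0 < r"
  \<comment> \<open>Chosen so that \<open>(c + 1) / t < r\<close>.\<close>
  define t where "t = 2 * (\<bar>c\<bar> + 1) / r"
  have t: "t > 0" using r by (simp add: t_def)
  have "(\<lambda>i. measure (measure_of_prob \<gamma>0) (A i)) \<longlonglongrightarrow> measure (measure_of_prob \<gamma>0) (\<Inter>i. A i)"
    using A by (intro P.finite_Lim_measure_decseq) auto
  then have "(\<lambda>i. 1 + (exp t - 1) * measure (measure_of_prob \<gamma>0) (A i)) \<longlonglongrightarrow> 1 + (exp t - 1) * 0"
    using A by (intro tendsto_intros) simp
  then have "\<forall>\<^sub>F i in sequentially. 1 + (exp t - 1) * measure (measure_of_prob \<gamma>0) (A i) < exp 1"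
    by (rule order_tendstoD) simp
  then obtain n where n: "\<And>i. i \<ge> n \<Longrightarrow> 1 + (exp t - 1) * measure (measure_of_prob \<gamma>0) (A i) < exp 1"
    by (auto simp: eventually_sequentially)
  show "\<exists>n. \<forall>i\<ge>n. norm (\<Lambda> (indicator (A i)) - 0) < r"
  proof (intro exI allI impI)
    fix i assume i: "n \<le> i"
    have Lm: "\<Lambda> \<in> means" using L by (simp add: entropic_means_def)
    note [measurable] = A(1)
    have bb: "indicator (A i) \<in> bounded_borel" by (rule bounded_borel_indicator) (rule A)
    have "t * \<Lambda> (indicator (A i)) = \<Lambda> (\<lambda>x. t * indicator (A i) x)"
      by (simp add: mean_cmult[OF Lm bb])
    also have "\<dots> \<le> c + ln (\<integral>x. exp (t * indicator (A i) x) \<partial>measure_of_prob \<gamma>0)"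
      using L bounded_borel_cmult[OF bb] by (simp add: entropic_means_def)
    also have "(\<lambda>x. exp (t * indicator (A i) x)) = (\<lambda>x. 1 + (exp t - 1) * indicator (A i) x)"
      by (auto simp: indicator_def)
    also have "(\<integral>x. 1 + (exp t - 1) * indicator (A i) x \<partial>measure_of_prob \<gamma>0) =
        1 + (exp t - 1) * measure (measure_of_prob \<gamma>0) (A i)"
      by (simp add: P.prob_space P.emeasure_eq_measure)
    also have "ln \<dots> \<le> ln (exp 1)"
    proof (rule ln_mono)
      have "0 \<le> (exp t - 1) * measure (measure_of_prob \<gamma>0) (A i)"
        using t by (intro mult_nonneg_nonneg) auto
      then show "0 < 1 + (exp t - 1) * measure (measure_of_prob \<gamma>0) (A i)" by linarith
    qed (use n[OF i] in auto)
    finally have "t * \<Lambda> (indicator (A i)) \<le> c + 1" by simp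
    also have "\<dots> < t * r" using r by (simp add: t_def)
    finally have "\<Lambda> (indicator (A i)) < r" using t by simp
    moreover have "0 \<le> \<Lambda> (indicator (A i))" by (rule mean_nonneg[OF Lm bb]) simp
    ultimately show "norm (\<Lambda> (indicator (A i)) - 0) < r" by simp
  qed
qed

lemma entropic_mean_is_expectation:
  fixes \<gamma>0 :: "'a::topological_space prob"
  assumes L: "\<Lambda> \<in> entropic_means \<gamma>0 c"
  shows "\<exists>\<gamma>. \<Lambda> = expect \<gamma>"
proof -
  have Lm: "\<Lambda> \<in> means" using L by (simp add: entropic_means_def)
  define m where "m A = ennreal (\<Lambda> (indicator A))" for A :: "'a set"
  interpret S: sigma_algebra UNIV "sets borel :: 'a set set"
    using sets.sigma_algebra_axioms[of "borel :: 'a measure"] by simp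
  have nonneg: "A \<in> sets borel \<Longrightarrow> 0 \<le> \<Lambda> (indicator A)" for A
    by (rule mean_nonneg[OF Lm bounded_borel_indicator]) auto
  have pos: "positive (sets borel) m"
    using mean_cmult[OF Lm bounded_borel_const, of 0 1] by (simp add: positive_def m_def indicator_def[abs_def])
  have add: "additive (sets borel) m"
  proof (unfold additive_def, intro ballI impI)
    fix A B :: "'a set" assume AB: "A \<in> sets borel" "B \<in> sets borel" "A \<inter> B = {}"
    have "indicator (A \<union> B) = (\<lambda>x. indicator A x + indicator B x :: real)"
      using AB(3) by (auto simp: indicator_def fun_eq_iff)
    then have "\<Lambda> (indicator (A \<union> B)) = \<Lambda> (indicator A) + \<Lambda> (indicator B)"
      using AB by (simp add: mean_add[OF Lm] bounded_borel_indicator)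
    then show "m (A \<union> B) = m A + m B" using AB nonneg by (simp add: m_def ennreal_plus)
  qed
  have ca: "countably_additive (sets borel) m"
  proof (rule S.empty_continuous_imp_countably_additive[OF pos add])
    fix A :: "nat \<Rightarrow> 'a set" assume A: "range A \<subseteq> sets borel" "decseq A" "(\<Inter>i. A i) = {}"
    have "(\<lambda>i. \<Lambda> (indicator (A i))) \<longlonglongrightarrow> 0"
      using A by (intro entropic_mean_continuous_at_empty[OF L]) auto
    then show "(\<lambda>i. m (A i)) \<longlonglongrightarrow> 0"
      unfolding m_def using tendsto_ennrealI by force
  qed (simp add: m_def)
  define M where "M = measure_of UNIV (sets borel) m"
  have em: "emeasure M A = m A" if "A \<in> sets borel" for A
    unfolding M_def by (rule emeasure_measure_of_sigma[OF S.sigma_algebra_axioms pos ca that])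
  have sM: "sets M = sets borel"
    unfolding M_def by (rule S.sets_measure_of_eq)
  have "m UNIV = 1" using mean_one[OF Lm] by (simp add: m_def indicator_def[abs_def])
  then have "prob_space M"
    using em[of UNIV] sets_eq_imp_space_eq[OF sM] by (intro prob_spaceI) simp
  then have M: "measure_of_prob (Prob M) = M" using sM by (intro Prob_inverse) simp
  have "\<Lambda> = expect (Prob M)"
  proof (rule mean_eqI[OF Lm expect_in_means])
    fix A :: "'a set" assume A: "A \<in> sets borel"
    show "\<Lambda> (indicator A) = expect (Prob M) (indicator A)"
      using A bounded_borel_indicator[OF A] nonneg[OF A] em[OF A] sM
      by (simp add: expect_def M measure_def m_def)
  qed
  then show ?thesis ..
qed

lemma entropic_means_eq: "entropic_means \<gamma>0 c = expect ` {\<gamma>. relative_entropy \<gamma> \<gamma>0 \<le> ereal c}"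
  using entropic_mean_is_expectation expect_entropic_iff by fastforce

lemma compact_entropic_means: "compact (entropic_means \<gamma>0 c)"
proof -
  have "closed {\<Lambda>. \<forall>g. g \<in> bounded_borel \<longrightarrow> \<Lambda> g \<le> c + ln (\<integral>x. exp (g x) \<partial>measure_of_prob \<gamma>0)}"
    by (intro closed_Collect_all closed_Collect_imp open_Collect_const closed_Collect_le
        continuous_intros continuous_on_product_coordinates)
  from compact_Int_closed[OF compact_means this] show ?thesis
    by (simp add: entropic_means_def Int_def Ball_def)
qed

text \<open>The closed constraints cut out a compact set of means, on which passing back to measures is continuous
  into the coarser weak topology.\<close>

theorem compact_relative_entropy_sublevel:
  fixes \<gamma>0 :: "'a::topological_space prob"
  shows "compact {\<gamma>. relative_entropy \<gamma> \<gamma>0 \<le> ereal c}"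
proof -
  have "continuous_on (entropic_means \<gamma>0 c) (inv expect)"
    unfolding continuous_on_open_invariant
  proof (intro allI impI)
    fix U :: "'a prob set" assume "open U"
    then obtain V where "open V" "U = expect -` V" using open_prob_expect by blast
    then show "\<exists>V. open V \<and> V \<inter> entropic_means \<gamma>0 c = inv expect -` U \<inter> entropic_means \<gamma>0 c"
      by (intro exI[of _ V]) (auto simp: entropic_means_eq inv_f_f[OF inj_expect])
  qed
  from compact_continuous_image[OF this compact_entropic_means]
  show ?thesis by (simp add: entropic_means_eq image_image inv_f_f[OF inj_expect])
qed

text \<open>The key to the upper bound for closed rather than compact sets. The open set \<open>- F\<close> is the trace of an
  open set \<open>V\<close> of means. A mean outside \<open>V\<close> violates some constraint, since otherwise it would be a
  measure in \<open>F\<close> of entropy at most \<open>c\<close>. Each violated constraint defines an open half-space, and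
  finitely many of them cover the compact set of means outside \<open>V\<close>. Compactness is thus taken from
  the space of means instead of \<open>F\<close>.\<close>

lemma closed_set_covered_by_halfspaces:
  fixes F :: "'a::topological_space prob set"
  assumes F: "closed F" and disj: "\<And>\<gamma>. \<gamma> \<in> F \<Longrightarrow> \<not> relative_entropy \<gamma> \<gamma>0 \<le> ereal c"
  obtains G where "finite G" "G \<subseteq> bounded_borel"
    "\<And>\<gamma>. \<gamma> \<in> F \<Longrightarrow> \<exists>g\<in>G. c + ln (\<integral>x. exp (g x) \<partial>measure_of_prob \<gamma>0) < (\<integral>x. g x \<partial>measure_of_prob \<gamma>)"
proof -
  obtain V where V: "open V" "- F = expect -` V"
    using open_prob_expect[of "- F"] F by (auto simp: open_Compl)
  define S where "S g = {\<Lambda>. c + ln (\<integral>x. exp (g x) \<partial>measure_of_prob \<gamma>0) < \<Lambda> g}" for g :: "'a \<Rightarrow> real"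
  have comp: "compact (means - V)"
    using compact_Int_closed[OF compact_means closed_Compl[OF V(1)]] by (simp add: Diff_eq)
  have op: "open (S g)" for g
    unfolding S_def by (intro open_Collect_less continuous_intros continuous_on_product_coordinates)
  have "means - V \<subseteq> (\<Union>g\<in>bounded_borel. S g)"
  proof
    fix \<Lambda> assume L: "\<Lambda> \<in> means - V"
    show "\<Lambda> \<in> (\<Union>g\<in>bounded_borel. S g)"
    proof (rule ccontr)
      assume "\<Lambda> \<notin> (\<Union>g\<in>bounded_borel. S g)"
      then have "\<Lambda> \<in> entropic_means \<gamma>0 c" using L by (auto simp: entropic_means_def S_def not_less)
      then obtain \<gamma> where "\<Lambda> = expect \<gamma>" "relative_entropy \<gamma> \<gamma>0 \<le> ereal c"
        unfolding entropic_means_eq by blast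
      then show False using L V(2) disj by blast
    qed
  qed
  from compactE_image[OF comp op this] obtain G where
    G: "G \<subseteq> bounded_borel" "finite G" "means - V \<subseteq> (\<Union>g\<in>G. S g)" by metis
  show ?thesis
  proof (rule that[OF G(2,1)])
    fix \<gamma> assume "\<gamma> \<in> F"
    then have "expect \<gamma> \<in> means - V" using V(2) expect_in_means by blast
    then obtain g where "g \<in> G" "expect \<gamma> \<in> S g" using G(3) by blast
    then show "\<exists>g\<in>G. c + ln (\<integral>x. exp (g x) \<partial>measure_of_prob \<gamma>0) < (\<integral>x. g x \<partial>measure_of_prob \<gamma>)"
      using G(1) by (intro bexI[of _ g]) (auto simp: S_def expect_def)
  qed
qed

section \<open>Independent samples\<close>

definition iid :: "nat \<Rightarrow> 'a::topological_space prob \<Rightarrow> (nat \<Rightarrow> 'a) measure" where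
  "iid N \<gamma> = (\<Pi>\<^sub>M i\<in>{1..N}. measure_of_prob \<gamma>)"

lemma prob_space_iid: "prob_space (iid N \<gamma>)"
  unfolding iid_def by (intro prob_space_PiM prob_space_measure_of_prob)

lemma sets_iid: "sets (iid N \<gamma>) = sets (\<Pi>\<^sub>M i\<in>{1..N}. borel)"
  unfolding iid_def by (intro sets_PiM_cong) auto

lemma measurable_iid_component:
  "i \<in> {1..N} \<Longrightarrow> (\<lambda>y. y i) \<in> borel_measurable (iid N \<gamma>)"
  unfolding iid_def using measurable_component_singleton[of i "{1..N}" "\<lambda>_. measure_of_prob \<gamma>"]
  by (simp cong: measurable_cong_sets)

lemma measurable_empirical_measure_iid:
  fixes \<gamma> :: "'a::second_countable_topology prob"
  assumes "N \<ge> 1"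
  shows "empirical_measure N \<in> borel_measurable (iid N \<gamma>)"
  using measurable_empirical_measure[OF assms measurable_iid_component] by simp

definition empirical_probability :: "nat \<Rightarrow> 'a::topological_space prob \<Rightarrow> 'a prob set \<Rightarrow> real" where
  "empirical_probability N \<gamma> A = measure (iid N \<gamma>) {y \<in> space (iid N \<gamma>). empirical_measure N y \<in> A}"

lemma nn_integral_iid_prod:
  fixes f :: "'a::topological_space \<Rightarrow> ennreal"
  assumes "f \<in> borel_measurable borel"
  shows "(\<integral>\<^sup>+y. (\<Prod>i=1..N. f (y i)) \<partial>iid N \<gamma>) = (\<integral>\<^sup>+x. f x \<partial>measure_of_prob \<gamma>) ^ N"
proof -
  interpret product_sigma_finite "\<lambda>_::nat. measure_of_prob \<gamma>"
    by (intro product_sigma_finite.intro prob_space_imp_sigma_finite prob_space_measure_of_prob)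
  show ?thesis unfolding iid_def using assms by (subst product_nn_integral_prod) auto
qed

text \<open>Markov's inequality for \<open>exp (\<Sum>i. g (y i))\<close>, whose expectation is the \<open>N\<close>-th power of that of \<open>e\<^sup>g\<close>.\<close>

lemma empirical_measure_halfspace_le:
  fixes \<gamma>0 :: "'a::second_countable_topology prob"
  assumes N: "N \<ge> 1" and g: "g \<in> bounded_borel"
  shows "measure (iid N \<gamma>0) {y \<in> space (iid N \<gamma>0).
      c + ln (\<integral>x. exp (g x) \<partial>measure_of_prob \<gamma>0) < (\<integral>x. g x \<partial>measure_of_prob (empirical_measure N y))}
    \<le> exp (- real N * c)"
proof -
  interpret prob_space "iid N \<gamma>0" by (rule prob_space_iid)
  define Z where "Z = (\<integral>x. exp (g x) \<partial>measure_of_prob \<gamma>0)"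
  have Z: "Z > 0" unfolding Z_def by (rule integral_exp_pos[OF g])
  have gm[measurable]: "g \<in> borel_measurable borel" using g by (simp add: bounded_borel_def)
  define u where "u y = (\<Prod>i=1..N. ennreal (exp (g (y i))))" for y :: "nat \<Rightarrow> 'a"
  have u: "u y = ennreal (exp (\<Sum>i=1..N. g (y i)))" for y
    by (simp add: u_def prod_ennreal exp_sum)
  have um[measurable]: "u \<in> borel_measurable (iid N \<gamma>0)"
    unfolding u_def by (intro borel_measurable_prod_ennreal measurable_compose[OF measurable_iid_component]) auto
  have "(\<integral>\<^sup>+x. ennreal (exp (g x)) \<partial>measure_of_prob \<gamma>0) = ennreal Z"
    unfolding Z_def by (intro nn_integral_eq_integral integrable_bounded_borel exp_bounded_borel g) simp
  then have int_u: "(\<integral>\<^sup>+y. u y \<partial>iid N \<gamma>0) = ennreal (Z ^ N)"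
    unfolding u_def using nn_integral_iid_prod[of "\<lambda>x. ennreal (exp (g x))" N \<gamma>0] Z by (simp add: ennreal_power)
  define K where "K = exp (- real N * c) / Z ^ N"
  have K: "K > 0" using Z by (simp add: K_def)
  have "{y \<in> space (iid N \<gamma>0). c + ln Z < (\<integral>x. g x \<partial>measure_of_prob (empirical_measure N y))}
      \<subseteq> {y \<in> space (iid N \<gamma>0). 1 \<le> ennreal K * u y}"
  proof safe
    fix y assume "c + ln Z < (\<integral>x. g x \<partial>measure_of_prob (empirical_measure N y))"
    then have "real N * c + real N * ln Z \<le> (\<Sum>i=1..N. g (y i))"
      using N by (simp add: integral_empirical_measure field_simps)
    then have "exp (real N * c + real N * ln Z) \<le> exp (\<Sum>i=1..N. g (y i))" by simp
    then have "exp (real N * c) * Z ^ N \<le> exp (\<Sum>i=1..N. g (y i))"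
      using Z by (simp add: exp_add exp_of_nat_mult)
    then have "1 \<le> K * exp (\<Sum>i=1..N. g (y i))"
      using Z by (simp add: K_def exp_minus field_simps)
    then show "1 \<le> ennreal K * u y"
      using K by (simp add: u ennreal_mult'[symmetric])
  qed
  then have "emeasure (iid N \<gamma>0) {y \<in> space (iid N \<gamma>0). c + ln Z < (\<integral>x. g x \<partial>measure_of_prob (empirical_measure N y))}
      \<le> emeasure (iid N \<gamma>0) {y \<in> space (iid N \<gamma>0). 1 \<le> ennreal K * u y}"
    by (rule emeasure_mono) measurable
  also have "\<dots> \<le> ennreal K * (\<integral>\<^sup>+y. u y * indicator (space (iid N \<gamma>0)) y \<partial>iid N \<gamma>0)"
    by (rule order_trans[OF _ nn_integral_Markov_inequality]) auto
  also have "\<dots> = ennreal K * ennreal (Z ^ N)"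
    using int_u by (simp cong: nn_integral_cong)
  also have "\<dots> = ennreal (exp (- real N * c))"
    using Z K by (simp add: ennreal_mult'[symmetric] K_def)
  finally show ?thesis
    by (simp add: emeasure_eq_measure Z_def)
qed

lemma iid_density:
  fixes \<gamma> \<gamma>0 :: "'a::topological_space prob" and H :: "'a \<Rightarrow> real"
  assumes H[measurable]: "H \<in> borel_measurable borel" and H_nonneg: "\<And>x. 0 \<le> H x"
    and dens: "measure_of_prob \<gamma> = density (measure_of_prob \<gamma>0) (\<lambda>x. ennreal (H x))"
  shows "iid N \<gamma> = density (iid N \<gamma>0) (\<lambda>y. ennreal (\<Prod>i=1..N. H (y i)))"
proof -
  interpret G: product_sigma_finite "\<lambda>_::nat. measure_of_prob \<gamma>"
    by (intro product_sigma_finite.intro prob_space_imp_sigma_finite prob_space_measure_of_prob)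
  have meas: "(\<lambda>y. ennreal (\<Prod>i=1..N. H (y i))) \<in> borel_measurable (iid N \<gamma>0)"
    by (intro measurable_compose[OF _ measurable_ennreal] borel_measurable_prod
        measurable_compose[OF measurable_iid_component H])
  have "density (iid N \<gamma>0) (\<lambda>y. ennreal (\<Prod>i=1..N. H (y i))) = (\<Pi>\<^sub>M i\<in>{1..N}. measure_of_prob \<gamma>)"
  proof (rule G.PiM_eqI)
    show "sets (density (iid N \<gamma>0) (\<lambda>y. ennreal (\<Prod>i=1..N. H (y i)))) = sets (\<Pi>\<^sub>M i\<in>{1..N}. measure_of_prob \<gamma>)"
      using sets_iid[of N \<gamma>0] sets_iid[of N \<gamma>] by (simp add: iid_def)
    fix A assume A: "\<And>i. i \<in> {1..N} \<Longrightarrow> A i \<in> sets (measure_of_prob \<gamma>)"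
    interpret P: product_sigma_finite "\<lambda>_::nat. measure_of_prob \<gamma>0"
      by (intro product_sigma_finite.intro prob_space_imp_sigma_finite prob_space_measure_of_prob)
    have A': "Pi\<^sub>E {1..N} A \<in> sets (iid N \<gamma>0)"
      unfolding iid_def using A by (intro sets_PiM_I_finite) auto
    have "emeasure (density (iid N \<gamma>0) (\<lambda>y. ennreal (\<Prod>i=1..N. H (y i)))) (Pi\<^sub>E {1..N} A) =
        (\<integral>\<^sup>+y. ennreal (\<Prod>i=1..N. H (y i)) * indicator (Pi\<^sub>E {1..N} A) y \<partial>iid N \<gamma>0)"
      by (rule emeasure_density[OF meas A'])
    also have "\<dots> = (\<integral>\<^sup>+y. (\<Prod>i=1..N. ennreal (H (y i)) * indicator (A i) (y i)) \<partial>iid N \<gamma>0)"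
    proof (rule nn_integral_cong)
      fix y assume "y \<in> space (iid N \<gamma>0)"
      then have "y \<in> extensional {1..N}" by (auto simp: iid_def space_PiM PiE_def)
      then have "indicator (Pi\<^sub>E {1..N} A) y = (\<Prod>i=1..N. indicator (A i) (y i) :: ennreal)"
        by (auto simp: indicator_def PiE_def Pi_def prod.neutral prod_zero_iff)
      then show "ennreal (\<Prod>i=1..N. H (y i)) * indicator (Pi\<^sub>E {1..N} A) y =
          (\<Prod>i=1..N. ennreal (H (y i)) * indicator (A i) (y i))"
        by (simp add: prod_ennreal H_nonneg prod.distrib)
    qed
    also have "\<dots> = (\<Prod>i=1..N. \<integral>\<^sup>+x. ennreal (H x) * indicator (A i) x \<partial>measure_of_prob \<gamma>0)"
      unfolding iid_def using A by (intro P.product_nn_integral_prod) auto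
    also have "\<dots> = (\<Prod>i=1..N. emeasure (measure_of_prob \<gamma>) (A i))"
      using A by (intro prod.cong refl) (simp add: dens emeasure_density)
    finally show "emeasure (density (iid N \<gamma>0) (\<lambda>y. ennreal (\<Prod>i=1..N. H (y i)))) (Pi\<^sub>E {1..N} A) =
        (\<Prod>i=1..N. emeasure (measure_of_prob \<gamma>) (A i))" .
  qed simp
  then show ?thesis by (simp add: iid_def)
qed

lemma distr_iid_component:
  "i \<in> {1..N} \<Longrightarrow> distr (iid N \<gamma>) borel (\<lambda>y. y i) = measure_of_prob \<gamma>"
  using distr_PiM_component[of "{1..N}" "\<lambda>_. measure_of_prob \<gamma>" i]
    distr_cong[OF refl, of borel "measure_of_prob \<gamma>" "iid N \<gamma>" "\<lambda>y. y i" "\<lambda>y. y i"]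
  unfolding iid_def by (simp add: prob_space_measure_of_prob)

text \<open>The Gibbs inequality for the \<open>N\<close>-fold products, tested with \<open>b = - ln p\<close> on \<open>E\<close> and 0 elsewhere, where \<open>p\<close>
  is the probability of \<open>E\<close> under \<open>\<gamma>0\<close>. The log-density of the product integrates to \<open>N r\<close>, and the
  exponential term is at most 2. The log-density enters only through its expectation, so mere integrability
  is enough.\<close>

lemma change_of_measure_iid:
  fixes \<gamma> \<gamma>0 :: "'a::topological_space prob"
  assumes fin: "relative_entropy \<gamma> \<gamma>0 = ereal r" and E[measurable]: "E \<in> sets (iid N \<gamma>0)"
    and pos: "measure (iid N \<gamma>) E > 0"
  shows "measure (iid N \<gamma>0) E > 0 \<and>
    - (real N * r + 1) \<le> measure (iid N \<gamma>) E * ln (measure (iid N \<gamma>0) E)"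
proof -
  interpret P: prob_space "iid N \<gamma>0" by (rule prob_space_iid)
  interpret Q: prob_space "iid N \<gamma>" by (rule prob_space_iid)
  obtain H where H: "H \<in> borel_measurable borel" "\<And>x. 0 \<le> H x"
    "measure_of_prob \<gamma> = density (measure_of_prob \<gamma>0) (\<lambda>x. ennreal (H x))"
    "integrable (measure_of_prob \<gamma>) (\<lambda>x. ln (H x))"
    "relative_entropy \<gamma> \<gamma>0 = ereal (\<integral>x. ln (H x) \<partial>measure_of_prob \<gamma>)"
    by (rule finite_relative_entropyE[of \<gamma> \<gamma>0]) (use fin in auto)
  note [measurable] = H(1) measurable_iid_component
  define HN where "HN y = (\<Prod>i=1..N. H (y i))" for y :: "nat \<Rightarrow> 'a"
  have HNm[measurable]: "HN \<in> borel_measurable (iid N \<gamma>0)"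
    unfolding HN_def by (intro borel_measurable_prod measurable_compose[OF measurable_iid_component H(1)])
  have dens: "iid N \<gamma> = density (iid N \<gamma>0) (\<lambda>y. ennreal (HN y))"
    unfolding HN_def by (rule iid_density[OF H(1-3)])
  have sets_eq: "sets (iid N \<gamma>) = sets (iid N \<gamma>0)" by (simp add: sets_iid)
  have AE1: "AE x in measure_of_prob \<gamma>. 0 < H x"
    unfolding H(3) using H(1) by (subst AE_density) auto
  have "AE y in iid N \<gamma>. 0 < H (y i)" if i: "i \<in> {1..N}" for i
    using AE1 unfolding distr_iid_component[OF i, of \<gamma>, symmetric]
    using measurable_iid_component[OF i] H(1) by (subst (asm) AE_distr_iff) auto
  then have AE_pos: "AE y in iid N \<gamma>. \<forall>i\<in>{1..N}. 0 < H (y i)"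
    by (subst AE_ball_countable) auto
  have int_i: "integrable (iid N \<gamma>) (\<lambda>y. ln (H (y i)))" 
      "(\<integral>y. ln (H (y i)) \<partial>iid N \<gamma>) = r" if i: "i \<in> {1..N}" for i
  proof -
    have "integrable (distr (iid N \<gamma>) borel (\<lambda>y. y i)) (\<lambda>x. ln (H x))"
      unfolding distr_iid_component[OF i] by (rule H)
    then show "integrable (iid N \<gamma>) (\<lambda>y. ln (H (y i)))"
      using measurable_iid_component[OF i] H(1) by (subst (asm) integrable_distr_eq) auto
    have "(\<integral>y. ln (H (y i)) \<partial>iid N \<gamma>) = (\<integral>x. ln (H x) \<partial>distr (iid N \<gamma>) borel (\<lambda>y. y i))"
      using measurable_iid_component[OF i] H(1) by (subst integral_distr) auto
    also have "\<dots> = r" unfolding distr_iid_component[OF i] using H(5) fin by simp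
    finally show "(\<integral>y. ln (H (y i)) \<partial>iid N \<gamma>) = r" .
  qed
  have ln_HN: "AE y in iid N \<gamma>. ln (HN y) = (\<Sum>i=1..N. ln (H (y i)))"
    using AE_pos by eventually_elim (force simp: HN_def intro: ln_prod)
  have int_sum: "integrable (iid N \<gamma>) (\<lambda>y. \<Sum>i=1..N. ln (H (y i)))"
    using int_i by auto
  have lnm: "(\<lambda>y. ln (HN y)) \<in> borel_measurable (iid N \<gamma>)"
    using HNm by (simp add: measurable_cong_sets[OF sets_eq refl])
  have int_ln: "integrable (iid N \<gamma>) (\<lambda>y. ln (HN y))"
    using int_sum ln_HN lnm by (subst integrable_cong_AE) auto
  have int_ln_eq: "(\<integral>y. ln (HN y) \<partial>iid N \<gamma>) = real N * r"
  proof -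
    have "(\<integral>y. ln (HN y) \<partial>iid N \<gamma>) = (\<integral>y. (\<Sum>i=1..N. ln (H (y i))) \<partial>iid N \<gamma>)"
      using int_sum ln_HN lnm by (intro integral_cong_AE) auto
    also have "\<dots> = real N * r" using int_i by (subst Bochner_Integration.integral_sum) auto
    finally show ?thesis .
  qed
  have posP: "measure (iid N \<gamma>0) E > 0"
  proof (rule ccontr)
    assume "\<not> ?thesis"
    then have "emeasure (iid N \<gamma>0) E = 0" by (simp add: P.emeasure_eq_measure zero_less_measure_iff)
    then have "AE y in iid N \<gamma>0. y \<notin> E" by (intro AE_not_in) (auto simp: null_sets_def)
    then have "AE y in iid N \<gamma>. y \<notin> E" unfolding dens by (subst AE_density) auto
    then have "measure (iid N \<gamma>) E = 0"
      using sets_eq by (subst (asm) Q.prob_eq_0[symmetric]) auto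
    with pos show False by simp
  qed
  define p where "p = measure (iid N \<gamma>0) E"
  define b where "b y = - ln p * indicator E y" for y
  have bm: "b \<in> borel_measurable (iid N \<gamma>0)" unfolding b_def by measurable
  have "(\<integral>y. b y \<partial>iid N \<gamma>) + 1 \<le> (\<integral>y. ln (HN y) \<partial>iid N \<gamma>) + (\<integral>y. exp (b y) \<partial>iid N \<gamma>0)"
  proof (rule gibbs_inequality[where B="\<bar>ln p\<bar>", OF P.prob_space_axioms Q.prob_space_axioms dens HNm _ int_ln bm])
    show "0 \<le> HN y" for y unfolding HN_def using H(2) by (intro prod_nonneg) auto
    show "\<bar>b y\<bar> \<le> \<bar>ln p\<bar>" for y by (auto simp: b_def indicator_def)
  qed
  moreover have "(\<integral>y. b y \<partial>iid N \<gamma>) = - ln p * measure (iid N \<gamma>) E"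
    unfolding b_def using sets_eq E by (simp add: Q.emeasure_eq_measure)
  moreover have "(\<integral>y. exp (b y) \<partial>iid N \<gamma>0) \<le> 2"
  proof -
    have "(\<integral>y. exp (b y) \<partial>iid N \<gamma>0) \<le> (\<integral>y. (1 / p) * indicator E y + 1 \<partial>iid N \<gamma>0)"
    proof (rule integral_mono)
      show "integrable (iid N \<gamma>0) (\<lambda>y. exp (b y))"
        using bm by (intro P.integrable_const_bound[where B="exp \<bar>ln p\<bar>"]) (auto simp: b_def indicator_def)
      show "integrable (iid N \<gamma>0) (\<lambda>y. (1 / p) * indicator E y + 1)"
        by (simp add: P.emeasure_eq_measure)
      show "exp (b y) \<le> (1 / p) * indicator E y + 1" for y
        using posP by (auto simp: b_def indicator_def p_def exp_minus field_simps)
    qed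
    also have "\<dots> = 2" using posP by (simp add: P.emeasure_eq_measure P.prob_space p_def)
    finally show ?thesis .
  qed
  ultimately show ?thesis using posP int_ln_eq by (simp add: p_def algebra_simps)
qed

lemma indep_vars_iid:
  assumes "N \<ge> 1"
  shows "prob_space.indep_vars (iid N \<gamma>) (\<lambda>_. borel) (\<lambda>i y. y i) {1..N}"
proof -
  interpret prob_space "iid N \<gamma>" by (rule prob_space_iid)
  have "distr (iid N \<gamma>) (\<Pi>\<^sub>M i\<in>{1..N}. borel) (\<lambda>y. \<lambda>i\<in>{1..N}. y i) = distr (iid N \<gamma>) (iid N \<gamma>) (\<lambda>y. y)"
  proof (rule distr_cong)
    show "(\<lambda>i\<in>{1..N}. y i) = y" if "y \<in> space (iid N \<gamma>)" for y
      using that by (auto simp: iid_def space_PiM PiE_def extensional_restrict)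
  qed (simp_all add: sets_iid)
  also have "\<dots> = (\<Pi>\<^sub>M i\<in>{1..N}. distr (iid N \<gamma>) borel (\<lambda>y. y i))"
    by (subst PiM_cong[OF refl distr_iid_component]) (auto simp: iid_def)
  finally show ?thesis
    using assms by (subst indep_vars_iff_distr_eq_PiM') (auto intro: measurable_iid_component)
qed

lemma tendsto_zero_squeeze:
  fixes u v :: "nat \<Rightarrow> real"
  assumes "\<And>N. 0 \<le> u N" "\<And>N. N \<ge> 1 \<Longrightarrow> u N \<le> v N" "v \<longlonglongrightarrow> 0"
  shows "u \<longlonglongrightarrow> 0"
proof (rule tendsto_sandwich[OF _ _ tendsto_const assms(3)])
  show "\<forall>\<^sub>F N in sequentially. u N \<le> v N"
    using eventually_ge_at_top[of 1] by eventually_elim (rule assms(2))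
qed (simp add: assms(1))

lemma one_minus_empirical_probability_nonneg: "0 \<le> 1 - empirical_probability N \<gamma> A"
  using prob_space.prob_le_1[OF prob_space_iid] by (simp add: empirical_probability_def)

lemma weak_law_bounded_borel:
  fixes \<gamma> :: "'a::second_countable_topology prob"
  assumes f: "f \<in> bounded_borel" and e: "e > 0"
  shows "(\<lambda>N. measure (iid N \<gamma>) {y \<in> space (iid N \<gamma>).
      e \<le> \<bar>(\<integral>x. f x \<partial>measure_of_prob (empirical_measure N y)) - (\<integral>x. f x \<partial>measure_of_prob \<gamma>)\<bar>}) \<longlonglongrightarrow> 0"
    (is "?p \<longlonglongrightarrow> 0")
proof -
  obtain B where B: "f \<in> borel_measurable borel" "\<And>x. \<bar>f x\<bar> \<le> B"
    using f by (rule bounded_borelE) blast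
  define b where "b = \<bar>B\<bar> + 1"
  have b: "b > 0" "f x \<in> {-b..b}" for x using B(2)[of x] by (auto simp: b_def)
  define m where "m = (\<integral>x. f x \<partial>measure_of_prob \<gamma>)"
  have le: "?p N \<le> 2 * exp (- (2 * e\<^sup>2 / (2 * b)\<^sup>2) * real N)" if N: "N \<ge> 1" for N
  proof -
    interpret prob_space "iid N \<gamma>" by (rule prob_space_iid)
    have 1: "1 \<in> {1..N}" using N by simp
    have fi: "(\<lambda>y. f (y i)) \<in> borel_measurable (iid N \<gamma>)" if "i \<in> {1..N}" for i
      by (rule measurable_compose[OF measurable_iid_component[OF that] B(1)])
    have d: "distr (iid N \<gamma>) borel (\<lambda>y. f (y i)) = distr (measure_of_prob \<gamma>) borel f" if "i \<in> {1..N}" for i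
      using distr_distr[OF B(1) measurable_iid_component[OF that, of \<gamma>]]
      unfolding distr_iid_component[OF that] by (simp add: comp_def)
    have m: "expectation (\<lambda>y. f (y 1)) = m"
      using integral_distr[OF measurable_iid_component[OF 1, of \<gamma>] B(1)]
      unfolding distr_iid_component[OF 1] by (simp add: m_def)
    interpret Hoeffding_ineq_iid "iid N \<gamma>" "{1..N}" "\<lambda>i y. f (y i)" "\<lambda>y. f (y 1)" "-b" b m
    proof unfold_locales
      show "indep_vars (\<lambda>_. borel) (\<lambda>i y. f (y i)) {1..N}"
        by (rule indep_vars_compose2[OF indep_vars_iid[OF N]]) (rule B)
    qed (use b d 1 fi m in auto)
    have "?p N = prob {y \<in> space (iid N \<gamma>). e \<le> \<bar>(\<Sum>i=1..N. f (y i)) / real (card {1..N}) - m\<bar>}"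
      using N B(1) by (simp add: integral_empirical_measure m_def)
    also have "\<dots> \<le> 2 * exp (-2 * real (card {1..N}) * e\<^sup>2 / (b - - b)\<^sup>2)"
      by (rule Hoeffding_ineq_abs_ge') (use e b 1 in auto)
    finally show ?thesis by (simp add: field_simps)
  qed
  have k: "2 * e\<^sup>2 / (2 * b)\<^sup>2 > 0" using e b by simp
  have "(\<lambda>N. 2 * exp (- (2 * e\<^sup>2 / (2 * b)\<^sup>2) * real N)) \<longlonglongrightarrow> 2 * 0"
    using k
    by (intro tendsto_mult tendsto_const filterlim_compose[OF exp_at_bot]
          filterlim_tendsto_neg_mult_at_bot[OF tendsto_const] filterlim_real_sequentially) auto
  then have lim: "(\<lambda>N. 2 * exp (- (2 * e\<^sup>2 / (2 * b)\<^sup>2) * real N)) \<longlonglongrightarrow> 0" by simp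
  show ?thesis
    by (rule tendsto_zero_squeeze[OF _ le lim]) simp_all
qed

text \<open>Sets with this property are closed under finite intersections and enlargement, so it is enough to
  check the subbasic sets of the weak topology, where it is the weak law for one bounded function.\<close>

lemma weak_law_empirical_measure:
  fixes \<gamma> :: "'a::second_countable_topology prob"
  assumes U: "open U" and mem: "\<gamma> \<in> U"
  shows "(\<lambda>N. empirical_probability N \<gamma> U) \<longlonglongrightarrow> 1"
proof -
  have ps: "prob_space (iid N \<gamma>)" for N by (rule prob_space_iid)
  have meas: "{y \<in> space (iid N \<gamma>). empirical_measure N y \<in> V} \<in> sets (iid N \<gamma>)"
    if "open V" "N \<ge> 1" for V N
    using measurable_sets[OF measurable_empirical_measure_iid[OF that(2), of \<gamma>] borel_open[OF that(1)]]
    by (simp add: vimage_def Int_def conj_commute)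
  \<comment> \<open>Openness is carried through the induction because it supplies the measurability of the events.\<close>
  have "(\<lambda>N. 1 - empirical_probability N \<gamma> U) \<longlonglongrightarrow> 0 \<and> open U"
    using U[unfolded open_prob_def] mem
  proof (induction rule: generate_topology.induct)
    case UNIV
    then show ?case using ps by (simp add: empirical_probability_def prob_space.prob_space)
  next
    case (Int a b)
    then have a: "(\<lambda>N. 1 - empirical_probability N \<gamma> a) \<longlonglongrightarrow> 0" "open a"
      and b: "(\<lambda>N. 1 - empirical_probability N \<gamma> b) \<longlonglongrightarrow> 0" "open b" by auto
    have le: "1 - empirical_probability N \<gamma> (a \<inter> b) \<le>
        (1 - empirical_probability N \<gamma> a) + (1 - empirical_probability N \<gamma> b)" if N: "N \<ge> 1" for N
    proof -
      interpret prob_space "iid N \<gamma>" by (rule ps)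
      let ?E = "\<lambda>V. {y \<in> space (iid N \<gamma>). empirical_measure N y \<in> V}"
      have "?E (a \<inter> b) = ?E a \<inter> ?E b" by auto
      then have "prob (?E (a \<inter> b)) = prob (?E a \<inter> ?E b)" by (simp only:)
      moreover have "prob (?E a) + prob (?E b) = prob (?E a \<union> ?E b) + prob (?E a \<inter> ?E b)"
        using meas[OF a(2) N] meas[OF b(2) N] by (simp add: measure_Un3 fmeasurable_eq_sets)
      moreover have "prob (?E a \<union> ?E b) \<le> 1" by simp
      ultimately show ?thesis unfolding empirical_probability_def by linarith
    qed
    have "(\<lambda>N. (1 - empirical_probability N \<gamma> a) + (1 - empirical_probability N \<gamma> b)) \<longlonglongrightarrow> 0"
      using tendsto_add[OF a(1) b(1)] by simp
    from tendsto_zero_squeeze[OF one_minus_empirical_probability_nonneg le this]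
    show ?case using a(2) b(2) by (simp add: open_Int)
  next
    case (UN K)
    then obtain k where k: "k \<in> K" "\<gamma> \<in> k" by blast
    with UN.IH have IH: "(\<lambda>N. 1 - empirical_probability N \<gamma> k) \<longlonglongrightarrow> 0" "open k" by auto
    have op: "open (\<Union>K)"
      unfolding open_prob_def using UN.hyps by (rule generate_topology.UN)
    have le: "1 - empirical_probability N \<gamma> (\<Union>K) \<le> 1 - empirical_probability N \<gamma> k" if N: "N \<ge> 1" for N
    proof -
      interpret prob_space "iid N \<gamma>" by (rule ps)
      show ?thesis
        unfolding empirical_probability_def
        using meas[OF op N] k by (intro diff_left_mono finite_measure_mono) auto
    qed
    from tendsto_zero_squeeze[OF one_minus_empirical_probability_nonneg le IH(1)]
    show ?case using op by simp
  next
    case (Basis s)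
    then obtain f :: "'a \<Rightarrow> real" and V where
      s: "s = {\<mu>. (\<integral>x. f x \<partial>measure_of_prob \<mu>) \<in> V}"
      and f: "continuous_on UNIV f" "bounded (range f)" "open V" by blast
    have op: "open s" unfolding open_prob_def using Basis by (intro generate_topology.Basis)
    have fb: "f \<in> bounded_borel" by (rule bounded_borel_continuous[OF f(1,2)])
    have "(\<integral>x. f x \<partial>measure_of_prob \<gamma>) \<in> V" using Basis s by simp
    then obtain e where e: "e > 0" "\<And>t. dist t (\<integral>x. f x \<partial>measure_of_prob \<gamma>) < e \<Longrightarrow> t \<in> V"
      using f(3) by (auto simp: open_dist)
    have le: "1 - empirical_probability N \<gamma> s \<le> measure (iid N \<gamma>) {y \<in> space (iid N \<gamma>).
      e \<le> \<bar>(\<integral>x. f x \<partial>measure_of_prob (empirical_measure N y)) - (\<integral>x. f x \<partial>measure_of_prob \<gamma>)\<bar>}"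
      (is "_ \<le> ?p N") if N: "N \<ge> 1" for N
    proof -
      interpret prob_space "iid N \<gamma>" by (rule ps)
      have [measurable]: "(\<lambda>y. \<integral>x. f x \<partial>measure_of_prob (empirical_measure N y)) \<in> borel_measurable (iid N \<gamma>)"
        using N fb by (auto simp: integral_empirical_measure bounded_borel_def
            intro!: borel_measurable_divide borel_measurable_sum measurable_compose[OF measurable_iid_component])
      have "1 - empirical_probability N \<gamma> s = prob (space (iid N \<gamma>) - {y \<in> space (iid N \<gamma>). empirical_measure N y \<in> s})"
        unfolding empirical_probability_def by (rule prob_compl[OF meas[OF op N], symmetric])
      also have "\<dots> \<le> ?p N"
        by (rule finite_measure_mono) (use e(2) in \<open>auto simp: s dist_real_def not_less[symmetric]\<close>)
      finally show ?thesis .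
    qed
    from tendsto_zero_squeeze[OF one_minus_empirical_probability_nonneg le weak_law_bounded_borel[OF fb e(1)]]
    show ?case using op by simp
  qed
  from tendsto_diff[OF tendsto_const[of 1] conjunct1[OF this]] show ?thesis by simp
qed

section \<open>The theorem of Sanov\<close>

lemma log_ereal_mono:
  assumes "0 \<le> p" "p \<le> q"
  shows "ereal (1 / real n) * log_ereal p \<le> ereal (1 / real n) * log_ereal q"
proof (rule ereal_mult_left_mono)
  show "log_ereal p \<le> log_ereal q" using assms by (auto simp: log_ereal_def)
qed simp

lemma scaled_log_ereal:
  assumes "p > 0"
  shows "ereal (1 / real n) * log_ereal p = ereal (ln p / real n)"
  using assms by (simp add: log_ereal_def)

lemma empirical_probability_mono_AE:
  fixes \<gamma> :: "'a::second_countable_topology prob"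
  assumes N: "N \<ge> 1" and B: "B \<in> sets borel"
    and "AE y in iid N \<gamma>. empirical_measure N y \<in> A \<longrightarrow> empirical_measure N y \<in> B"
  shows "empirical_probability N \<gamma> A \<le> empirical_probability N \<gamma> B"
proof -
  interpret prob_space "iid N \<gamma>" by (rule prob_space_iid)
  have "{y \<in> space (iid N \<gamma>). empirical_measure N y \<in> B} \<in> sets (iid N \<gamma>)"
    using measurable_sets[OF measurable_empirical_measure_iid[OF N, of \<gamma>] B]
    by (simp add: vimage_def Int_def conj_commute)
  then show ?thesis
    unfolding empirical_probability_def using assms(3) by (intro finite_measure_mono_AE) auto
qed

text \<open>A union bound over the finitely many half-spaces that cover \<open>F\<close>; their number disappears on the
  exponential scale.\<close>

theorem sanov_upper_bound:
  fixes \<gamma>0 :: "'a::second_countable_topology prob"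
  assumes F: "closed F" and disj: "\<And>\<gamma>. \<gamma> \<in> F \<Longrightarrow> \<not> relative_entropy \<gamma> \<gamma>0 \<le> ereal c"
  shows "limsup (\<lambda>N. ereal (1 / real N) * log_ereal (empirical_probability N \<gamma>0 F)) \<le> ereal (- c)"
proof -
  obtain G where G: "finite G" "G \<subseteq> bounded_borel"
    "\<And>\<gamma>. \<gamma> \<in> F \<Longrightarrow> \<exists>g\<in>G. c + ln (\<integral>x. exp (g x) \<partial>measure_of_prob \<gamma>0) < (\<integral>x. g x \<partial>measure_of_prob \<gamma>)"
    using closed_set_covered_by_halfspaces[OF F disj] by metis
  \<comment> \<open>The summand 1 keeps \<open>K\<close> positive when \<open>G\<close> is empty.\<close>
  define K where "K = real (card G) + 1"
  have K: "K > 0" by (simp add: K_def)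
  have bound: "empirical_probability N \<gamma>0 F \<le> K * exp (- real N * c)" if N: "N \<ge> 1" for N
  proof -
    interpret prob_space "iid N \<gamma>0" by (rule prob_space_iid)
    define S where "S g = {y \<in> space (iid N \<gamma>0). c + ln (\<integral>x. exp (g x) \<partial>measure_of_prob \<gamma>0)
      < (\<integral>x. g x \<partial>measure_of_prob (empirical_measure N y))}" for g
    have S: "S g \<in> sets (iid N \<gamma>0)" if "g \<in> G" for g
    proof -
      have [measurable]: "g \<in> borel_measurable borel" using that G by (auto simp: bounded_borel_def)
      have [measurable]: "(\<lambda>y. \<integral>x. g x \<partial>measure_of_prob (empirical_measure N y)) \<in> borel_measurable (iid N \<gamma>0)"
        using N by (auto simp: integral_empirical_measure
            intro!: borel_measurable_divide borel_measurable_sum measurable_compose[OF measurable_iid_component])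
      show ?thesis unfolding S_def by measurable
    qed
    have "empirical_probability N \<gamma>0 F \<le> prob (\<Union>g\<in>G. S g)"
      unfolding empirical_probability_def using G S
      by (intro finite_measure_mono sets.finite_UN) (auto simp: S_def)
    also have "\<dots> \<le> (\<Sum>g\<in>G. prob (S g))"
      using G S by (intro finite_measure_subadditive_finite) auto
    also have "\<dots> \<le> (\<Sum>g\<in>G. exp (- real N * c))"
      using G(2) unfolding S_def by (intro sum_mono empirical_measure_halfspace_le[OF N]) auto
    also have "\<dots> \<le> K * exp (- real N * c)" by (simp add: K_def algebra_simps)
    finally show ?thesis .
  qed
  have "\<forall>\<^sub>F N in sequentially. ereal (1 / real N) * log_ereal (empirical_probability N \<gamma>0 F)
      \<le> ereal (ln K * (1 / real N) - c)"
    using eventually_ge_at_top[of 1]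
  proof eventually_elim
    case (elim N)
    have "ereal (1 / real N) * log_ereal (empirical_probability N \<gamma>0 F)
        \<le> ereal (1 / real N) * log_ereal (K * exp (- real N * c))"
      by (rule log_ereal_mono[OF _ bound[OF elim]]) (simp add: empirical_probability_def)
    also have "\<dots> = ereal (ln (K * exp (- real N * c)) / real N)"
      using K by (intro scaled_log_ereal) simp
    also have "ln (K * exp (- real N * c)) / real N = ln K * (1 / real N) - c"
      using K elim by (simp add: ln_mult field_simps)
    finally show ?case .
  qed
  then have "limsup (\<lambda>N. ereal (1 / real N) * log_ereal (empirical_probability N \<gamma>0 F))
      \<le> limsup (\<lambda>N. ereal (ln K * (1 / real N) - c))"
    by (rule Limsup_mono)
  also have "\<dots> = ereal (- c)"
  proof (rule lim_imp_Limsup)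
    have "(\<lambda>N. ln K * (1 / real N) - c) \<longlonglongrightarrow> ln K * 0 - c"
      by (intro tendsto_intros lim_1_over_n)
    then show "(\<lambda>N. ereal (ln K * (1 / real N) - c)) \<longlonglongrightarrow> ereal (- c)" by simp
  qed simp
  finally show ?thesis .
qed

text \<open>Under \<open>\<gamma>\<close> the empirical measure lies in \<open>U\<close> with probability tending to 1; the change of measure
  converts this into a bound under \<open>\<gamma>0\<close>.\<close>

theorem sanov_lower_bound:
  fixes \<gamma>0 :: "'a::second_countable_topology prob"
  assumes U: "open U" and mem: "\<gamma> \<in> U"
  shows "- relative_entropy \<gamma> \<gamma>0 \<le>
    liminf (\<lambda>N. ereal (1 / real N) * log_ereal (empirical_probability N \<gamma>0 U))"
proof (cases "relative_entropy \<gamma> \<gamma>0 < \<infinity>")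
  case True
  then obtain r where r: "relative_entropy \<gamma> \<gamma>0 = ereal r"
    by (rule finite_relative_entropyE)
  define q where "q N = empirical_probability N \<gamma> U" for N
  have q: "q \<longlonglongrightarrow> 1" unfolding q_def by (rule weak_law_empirical_measure[OF U mem])
  have "\<forall>\<^sub>F N in sequentially. 0 < q N" using order_tendstoD(1)[OF q, of 0] by simp
  then have "\<forall>\<^sub>F N in sequentially. ereal (- (r + 1 / real N) / q N)
      \<le> ereal (1 / real N) * log_ereal (empirical_probability N \<gamma>0 U)"
    using eventually_ge_at_top[of 1]
  proof eventually_elim
    case (elim N)
    define E where "E = {y \<in> space (iid N \<gamma>0). empirical_measure N y \<in> U}"
    have sp: "space (iid N \<gamma>) = space (iid N \<gamma>0)"
      by (rule sets_eq_imp_space_eq) (simp add: sets_iid)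
    have E: "E \<in> sets (iid N \<gamma>0)"
      using measurable_sets[OF measurable_empirical_measure_iid[OF elim(2), of \<gamma>0] borel_open[OF U]]
      by (simp add: E_def vimage_def Int_def conj_commute)
    have qE: "measure (iid N \<gamma>) E = q N"
      by (simp add: q_def empirical_probability_def E_def sp)
    define p where "p = empirical_probability N \<gamma>0 U"
    have pE: "measure (iid N \<gamma>0) E = p"
      by (simp add: p_def empirical_probability_def E_def)
    have "0 < p" "- (real N * r + 1) \<le> q N * ln p"
      using change_of_measure_iid[OF r E] elim unfolding qE pE by auto
    then have "- (real N * r + 1) / q N \<le> ln p"
      using elim by (simp add: divide_le_eq mult.commute)
    then have "(- (real N * r + 1) / q N) / real N \<le> ln p / real N"
      by (rule divide_right_mono) simp
    also have "(- (real N * r + 1) / q N) / real N = - (r + 1 / real N) / q N"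
      using elim by (simp add: field_simps)
    finally have "- (r + 1 / real N) / q N \<le> ln p / real N" .
    also have "ereal \<dots> = ereal (1 / real N) * log_ereal p"
      using \<open>0 < p\<close> by (simp add: scaled_log_ereal)
    finally show ?case by (simp add: p_def)
  qed
  then have "liminf (\<lambda>N. ereal (- (r + 1 / real N) / q N)) \<le>
      liminf (\<lambda>N. ereal (1 / real N) * log_ereal (empirical_probability N \<gamma>0 U))"
    by (rule Liminf_mono)
  moreover have "liminf (\<lambda>N. ereal (- (r + 1 / real N) / q N)) = ereal (- r)"
  proof (rule lim_imp_Liminf)
    have "(\<lambda>N. - (r + 1 / real N) / q N) \<longlonglongrightarrow> - (r + 0) / 1"
      by (intro tendsto_intros lim_1_over_n q) simp
    then show "(\<lambda>N. ereal (- (r + 1 / real N) / q N)) \<longlonglongrightarrow> ereal (- r)" by simp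
  qed simp
  ultimately show ?thesis by (simp add: r)
qed simp

section \<open>Contraction along a map that is continuous where the entropy is finite\<close>

lemma relative_entropy_nonneg: "0 \<le> relative_entropy \<gamma> \<gamma>0"
proof (cases "relative_entropy \<gamma> \<gamma>0 < \<infinity>")
  case True
  then obtain r where r: "relative_entropy \<gamma> \<gamma>0 = ereal r"
    by (rule finite_relative_entropyE)
  have "(\<integral>x. 0 \<partial>measure_of_prob \<gamma>) \<le> r + ln (\<integral>x. exp 0 \<partial>measure_of_prob \<gamma>0)"
    by (rule donsker_varadhan_le) (auto simp: r bounded_borel_const)
  then show ?thesis by (simp add: r)
qed simp

lemma good_rate_functionI:
  fixes I :: "'a::t2_space \<Rightarrow> ereal"
  assumes nonneg: "\<And>x. 0 \<le> I x" and comp: "\<And>c::real. compact {x. I x \<le> ereal c}"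
  shows "good_rate_function I"
  unfolding good_rate_function_def rate_function_def
proof (intro conjI allI impI)
  fix x
  show "I x \<le> Liminf (at x) I"
  proof (unfold le_Liminf_iff, intro allI impI)
    fix y assume y: "y < I x"
    show "\<forall>\<^sub>F z in at x. y < I z"
    proof (cases y)
      case (real c)
      have "open (- {z. I z \<le> ereal c})" using compact_imp_closed[OF comp] by (rule open_Compl)
      moreover have "x \<in> - {z. I z \<le> ereal c}" using y real by simp
      ultimately have "\<forall>\<^sub>F z in at x. z \<in> - {z. I z \<le> ereal c}" by (rule eventually_at_in_open')
      then show ?thesis by eventually_elim (simp add: real)
    next
      case MInf
      then show ?thesis using nonneg by (auto intro!: always_eventually less_le_trans[of _ 0])
    qed (use y in simp)
  qed
qed (auto intro: nonneg comp)

text \<open>Sublevel sets of the infimum are intersections of the continuous images \<open>h ` {R \<le> c + 1 / n}\<close>. These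
  images are compact because \<open>R\<close> is finite, hence \<open>h\<close> continuous along \<open>D\<close>, at every point of the
  sublevel sets of \<open>R\<close>.\<close>

lemma compact_sublevel_of_infimum_over_fibre:
  fixes R :: "'a::topological_space \<Rightarrow> ereal" and h :: "'a \<Rightarrow> 'b::t2_space"
  assumes comp: "\<And>c::real. compact {\<gamma>. R \<gamma> \<le> ereal c}"
    and sub: "\<And>\<gamma>. R \<gamma> < \<infinity> \<Longrightarrow> \<gamma> \<in> D \<and> (h \<longlongrightarrow> h \<gamma>) (at \<gamma> within D)"
  shows "compact {\<eta>. (INF \<gamma>\<in>{\<gamma> \<in> D. h \<gamma> = \<eta>}. R \<gamma>) \<le> ereal c}"
proof -
  define K where "K n = {\<gamma>. R \<gamma> \<le> ereal (c + 1 / real (Suc n))}" for n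
  have KD: "\<gamma> \<in> D \<and> (h \<longlongrightarrow> h \<gamma>) (at \<gamma> within D)" if "\<gamma> \<in> K n" for \<gamma> n
    using that by (intro sub) (auto simp: K_def intro: le_less_trans)
  have "continuous_on (K n) h" for n
    unfolding continuous_on_def using KD by (blast intro: tendsto_within_subset)
  then have comp_K: "compact (h ` K n)" for n
    by (rule compact_continuous_image) (simp only: K_def comp)
  have "{\<eta>. (INF \<gamma>\<in>{\<gamma> \<in> D. h \<gamma> = \<eta>}. R \<gamma>) \<le> ereal c} = (\<Inter>n. h ` K n)"
  proof (intro subset_antisym subsetI)
    fix \<eta> assume \<eta>: "\<eta> \<in> {\<eta>. (INF \<gamma>\<in>{\<gamma> \<in> D. h \<gamma> = \<eta>}. R \<gamma>) \<le> ereal c}"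
    have "\<eta> \<in> h ` K n" for n
    proof -
      have "(INF \<gamma>\<in>{\<gamma> \<in> D. h \<gamma> = \<eta>}. R \<gamma>) < ereal (c + 1 / real (Suc n))"
        using \<eta> by (auto intro: le_less_trans)
      then show ?thesis by (auto simp: INF_less_iff K_def intro: less_imp_le)
    qed
    then show "\<eta> \<in> (\<Inter>n. h ` K n)" by blast
  next
    fix \<eta> assume \<eta>: "\<eta> \<in> (\<Inter>n. h ` K n)"
    have le: "(INF \<gamma>\<in>{\<gamma> \<in> D. h \<gamma> = \<eta>}. R \<gamma>) \<le> ereal (c + 1 / real (Suc n))" for n
    proof -
      obtain \<gamma> where "\<gamma> \<in> K n" "h \<gamma> = \<eta>" using \<eta> by blast
      then show ?thesis using KD[of \<gamma> n] by (intro INF_lower2[of \<gamma>]) (auto simp: K_def)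
    qed
    have "(\<lambda>n. c + 1 / real (Suc n)) \<longlonglongrightarrow> c + 0"
      using LIMSEQ_inverse_real_of_nat by (intro tendsto_add tendsto_const) (simp add: inverse_eq_divide)
    then have "(\<lambda>n. ereal (c + 1 / real (Suc n))) \<longlonglongrightarrow> ereal c" by simp
    from LIMSEQ_le_const[OF this] le
    show "\<eta> \<in> {\<eta>. (INF \<gamma>\<in>{\<gamma> \<in> D. h \<gamma> = \<eta>}. R \<gamma>) \<le> ereal c}" by blast
  qed
  also have "\<dots> = h ` K 0 \<inter> (\<Inter>n. h ` K n)" by blast
  also have "compact \<dots>"
    by (intro compact_Int_closed comp_K closed_INT ballI compact_imp_closed)
  finally show ?thesis .
qed

text \<open>This carries the upper bound through \<open>h\<close>: the closure of the preimage of \<open>B\<close> may contain points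
  outside the preimage of \<open>closure B\<close>, but never one where \<open>h\<close> is continuous along \<open>D\<close>.\<close>

lemma limit_point_in_closure_image:
  assumes cont: "(h \<longlongrightarrow> h \<gamma>) (at \<gamma> within D)" and cl: "\<gamma> \<in> closure {\<gamma> \<in> D. h \<gamma> \<in> B}"
  shows "h \<gamma> \<in> closure B"
proof (rule ccontr)
  assume "h \<gamma> \<notin> closure B"
  then have "\<forall>\<^sub>F x in at \<gamma> within D. h x \<in> - closure B"
    by (intro topological_tendstoD[OF cont]) auto
  then obtain S where S: "open S" "\<gamma> \<in> S" "\<And>x. x \<in> S \<Longrightarrow> x \<in> D \<Longrightarrow> x \<noteq> \<gamma> \<Longrightarrow> h x \<notin> closure B"
    by (auto simp: eventually_at_topological)
  have "S \<inter> {\<gamma> \<in> D. h \<gamma> \<in> B} \<noteq> {}"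
    using cl S(1,2) by (auto simp: closure_iff_nhds_not_empty)
  then obtain x where "x \<in> S" "x \<in> D" "h x \<in> B" by blast
  then show False using S(3)[of x] \<open>h \<gamma> \<notin> closure B\<close> closure_subset by blast
qed

section \<open>Weakly interacting particles\<close>

lemma empirical_measure_law:
  fixes Y :: "nat \<Rightarrow> 'w \<Rightarrow> 'a::second_countable_topology"
  assumes N: "N \<ge> 1" and M: "prob_space M"
    and Y: "\<And>i. i \<in> {1..N} \<Longrightarrow> Y i \<in> borel_measurable M"
    and indep: "prob_space.indep_vars M (\<lambda>_. borel) Y {1..N}"
    and dist: "\<And>i. i \<in> {1..N} \<Longrightarrow> distr M borel (Y i) = measure_of_prob \<gamma>0"
    and A: "A \<in> sets borel"
  shows "measure M {\<omega> \<in> space M. empirical_measure N (\<lambda>i. Y i \<omega>) \<in> A} = empirical_probability N \<gamma>0 A"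
proof -
  interpret prob_space M by (rule M)
  define T where "T \<omega> = (\<lambda>i\<in>{1..N}. Y i \<omega>)" for \<omega>
  have T: "T \<in> measurable M (\<Pi>\<^sub>M i\<in>{1..N}. borel)"
    unfolding T_def using Y by (intro measurable_restrict) auto
  have "distr M (\<Pi>\<^sub>M i\<in>{1..N}. borel) T = (\<Pi>\<^sub>M i\<in>{1..N}. distr M borel (Y i))"
    unfolding T_def using N indep_vars_iff_distr_eq_PiM'[of "{1..N}" Y "\<lambda>_. borel"] Y indep by auto
  also have "\<dots> = iid N \<gamma>0"
    unfolding iid_def using dist by (intro PiM_cong) auto
  finally have d: "distr M (\<Pi>\<^sub>M i\<in>{1..N}. borel) T = iid N \<gamma>0" .
  have S: "{y \<in> space (iid N \<gamma>0). empirical_measure N y \<in> A} \<in> sets (\<Pi>\<^sub>M i\<in>{1..N}. borel)"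
    using measurable_sets[OF measurable_empirical_measure_iid[OF N, of \<gamma>0] A] sets_iid[of N \<gamma>0]
    by (simp add: vimage_def Int_def conj_commute)
  have sp: "space (iid N \<gamma>0) = space (\<Pi>\<^sub>M i\<in>{1..N}. borel)"
    by (rule sets_eq_imp_space_eq[OF sets_iid])
  have emp: "empirical_measure N (T \<omega>) = empirical_measure N (\<lambda>i. Y i \<omega>)" for \<omega>
    by (rule empirical_measure_cong) (simp add: T_def)
  have "empirical_probability N \<gamma>0 A = measure (distr M (\<Pi>\<^sub>M i\<in>{1..N}. borel) T)
      {y \<in> space (iid N \<gamma>0). empirical_measure N y \<in> A}"
    unfolding empirical_probability_def d ..
  also have "\<dots> = measure M (T -` {y \<in> space (iid N \<gamma>0). empirical_measure N y \<in> A} \<inter> space M)"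
    by (rule measure_distr[OF T S])
  also have "T -` {y \<in> space (iid N \<gamma>0). empirical_measure N y \<in> A} \<inter> space M =
      {\<omega> \<in> space M. empirical_measure N (\<lambda>i. Y i \<omega>) \<in> A}"
    using measurable_space[OF T] by (auto simp: sp emp)
  finally show ?thesis by simp
qed

text \<open>Freezing the interaction at its realised value makes \<open>\<psi>\<close> a function of the noise alone, and the empirical
  measure of the particles becomes the image of that of the noise.\<close>

lemma fixed_point_of_empirical_measure:
  fixes \<psi> :: "'x::topological_space prob \<times> 'y::topological_space \<Rightarrow> 'x"
  assumes psi: "\<psi> \<in> borel_measurable borel" and N: "N \<ge> 1"
    and eq: "\<And>i. i \<in> {1..N} \<Longrightarrow> x i = \<psi> (empirical_measure N x, y i)"
  shows "empirical_measure N x =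
    image_prob (\<lambda>z. \<psi> (empirical_measure N x, z)) (empirical_measure N y)"
proof -
  have m: "(\<lambda>z. \<psi> (empirical_measure N x, z)) \<in> borel_measurable borel"
    by (rule measurable_compose[OF borel_measurable_continuous_onI psi]) (intro continuous_intros)
  have "empirical_measure N x = empirical_measure N (\<lambda>i. \<psi> (empirical_measure N x, y i))"
    by (rule empirical_measure_cong) (rule eq)
  also have "\<dots> = image_prob (\<lambda>z. \<psi> (empirical_measure N x, z)) (empirical_measure N y)"
    by (rule empirical_measure_image_prob[OF N m])
  finally show ?thesis .
qed

theorem theorem4p1:
  fixes \<gamma>0 :: "'y::polish_space prob"
    and \<psi> :: "'x::polish_space prob \<times> 'y \<Rightarrow> 'x"
    and P :: "nat \<Rightarrow> 'w measure"
    and X :: "nat \<Rightarrow> nat \<Rightarrow> 'w \<Rightarrow> 'x"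
    and Y :: "nat \<Rightarrow> nat \<Rightarrow> 'w \<Rightarrow> 'y"
    and D :: "'y prob set"
    and \<mu>_star :: "'y prob \<Rightarrow> 'x prob"
  defines "\<mu> \<equiv> \<lambda>N \<omega>. empirical_measure N (\<lambda>i. X N i \<omega>)"
    and "\<Psi> \<equiv> \<lambda>\<gamma> \<eta>. image_prob (\<lambda>y. \<psi> (\<eta>, y)) \<gamma>"
  assumes psi: "\<psi> \<in> borel_measurable borel"
    and P: "\<And>N. N \<ge> 1 \<Longrightarrow> prob_space (P N)"
    and X: "\<And>N i. N \<ge> 1 \<Longrightarrow> i \<in> {1..N} \<Longrightarrow> X N i \<in> borel_measurable (P N)"
    and Y: "\<And>N i. N \<ge> 1 \<Longrightarrow> i \<in> {1..N} \<Longrightarrow> Y N i \<in> borel_measurable (P N)"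
    and Y_indep: "\<And>N. N \<ge> 1 \<Longrightarrow> prob_space.indep_vars (P N) (\<lambda>_. borel) (Y N) {1..N}"
    and Y_distr: "\<And>N i. N \<ge> 1 \<Longrightarrow> i \<in> {1..N} \<Longrightarrow> distr (P N) borel (Y N i) = measure_of_prob \<gamma>0"
    and X_eq: "\<And>N i. N \<ge> 1 \<Longrightarrow> i \<in> {1..N} \<Longrightarrow> AE \<omega> in P N. X N i \<omega> = \<psi> (\<mu> N \<omega>, Y N i \<omega>)"
    and D: "D \<in> sets borel"
    and A1_solution: "\<And>\<gamma>. \<gamma> \<in> D \<Longrightarrow> \<mu>_star \<gamma> = \<Psi> \<gamma> (\<mu>_star \<gamma>)"
    and A1_unique: "\<And>\<gamma> \<eta>. \<gamma> \<in> D \<Longrightarrow> \<eta> = \<Psi> \<gamma> \<eta> \<Longrightarrow> \<eta> = \<mu>_star \<gamma>"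
    and A1_measurable: "\<mu>_star \<in> borel_measurable (restrict_space borel D)"
    and A2: "\<And>N. N \<ge> 1 \<Longrightarrow>
      measure (\<Pi>\<^sub>M i\<in>{1..N}. measure_of_prob \<gamma>0)
        {y \<in> space (\<Pi>\<^sub>M i\<in>{1..N}. measure_of_prob \<gamma>0). empirical_measure N y \<in> D} = 1"
    and A3: "\<And>\<gamma>. relative_entropy \<gamma> \<gamma>0 < \<infinity> \<Longrightarrow> \<gamma> \<in> D \<and> (\<mu>_star \<longlongrightarrow> \<mu>_star \<gamma>) (at \<gamma> within D)"
  defines "I \<equiv> \<lambda>\<eta>. INF \<gamma>\<in>{\<gamma> \<in> D. \<mu>_star \<gamma> = \<eta>}. relative_entropy \<gamma> \<gamma>0"
  shows "good_rate_function I \<and> large_deviation_principle P \<mu> I"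
proof
  have I_nonneg: "0 \<le> I \<eta>" for \<eta>
    unfolding I_def by (intro INF_greatest relative_entropy_nonneg)
  show good: "good_rate_function I"
    unfolding I_def
    using I_nonneg[unfolded I_def] compact_sublevel_of_infimum_over_fibre[OF compact_relative_entropy_sublevel A3]
    by (rule good_rate_functionI)
  have meas_\<mu>: "\<mu> N \<in> borel_measurable (P N)" if "N \<ge> 1" for N
    unfolding \<mu>_def using that X by (intro measurable_empirical_measure) auto
  \<comment> \<open>The preimage of \<open>B\<close>: up to null sets, the particle system hits \<open>B\<close> exactly when the empirical
    measure of the noise hits \<open>A B\<close>.\<close>
  define A where "A B = {\<gamma> \<in> D. \<mu>_star \<gamma> \<in> B}" for B
  have A: "A B \<in> sets borel" if "B \<in> sets borel" for B
  proof -
    have "\<mu>_star -` B \<inter> space (restrict_space borel D) \<in> sets (restrict_space borel D)"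
      by (rule measurable_sets[OF A1_measurable that])
    moreover have "\<mu>_star -` B \<inter> space (restrict_space borel D) = A B"
      by (auto simp: A_def space_restrict_space)
    ultimately show ?thesis using D by (simp add: sets_restrict_space_iff)
  qed
  have AE_D: "AE y in iid N \<gamma>0. empirical_measure N y \<in> D" if N: "N \<ge> 1" for N
  proof -
    interpret prob_space "iid N \<gamma>0" by (rule prob_space_iid)
    have "AE y in iid N \<gamma>0. y \<in> {y \<in> space (iid N \<gamma>0). empirical_measure N y \<in> D}"
      using A2[OF N] by (intro AE_prob_1) (simp add: iid_def)
    then show ?thesis by eventually_elim simp
  qed
  have law: "measure (P N) {\<omega> \<in> space (P N). \<mu> N \<omega> \<in> B} = empirical_probability N \<gamma>0 (A B)"
    if B: "B \<in> sets borel" and N: "N \<ge> 1" for N B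
  proof -
    interpret prob_space "P N" by (rule P[OF N])
    let ?\<gamma> = "\<lambda>\<omega>. empirical_measure N (\<lambda>i. Y N i \<omega>)"
    have meas_\<gamma>: "?\<gamma> \<in> borel_measurable (P N)"
      using N Y by (intro measurable_empirical_measure) auto
    have law_\<gamma>: "measure (P N) {\<omega> \<in> space (P N). ?\<gamma> \<omega> \<in> C} = empirical_probability N \<gamma>0 C"
      if "C \<in> sets borel" for C
      by (rule empirical_measure_law[OF N P[OF N] Y[OF N] Y_indep[OF N] Y_distr[OF N] that])
    have "prob {\<omega> \<in> space (P N). ?\<gamma> \<omega> \<in> D} = 1"
      unfolding law_\<gamma>[OF D] empirical_probability_def iid_def by (rule A2[OF N])
    then have "AE \<omega> in P N. \<omega> \<in> {\<omega> \<in> space (P N). ?\<gamma> \<omega> \<in> D}" by (rule AE_prob_1)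
    moreover have "AE \<omega> in P N. \<forall>i\<in>{1..N}. X N i \<omega> = \<psi> (\<mu> N \<omega>, Y N i \<omega>)"
      using X_eq[OF N] by (subst AE_ball_countable) auto
    ultimately have "AE \<omega> in P N. ?\<gamma> \<omega> \<in> D \<and> \<mu> N \<omega> = \<mu>_star (?\<gamma> \<omega>)"
    proof eventually_elim
      case (elim \<omega>)
      have "\<mu> N \<omega> = \<Psi> (?\<gamma> \<omega>) (\<mu> N \<omega>)"
        using elim(2) unfolding \<mu>_def \<Psi>_def
        by (intro fixed_point_of_empirical_measure[OF psi N]) auto
      then show ?case using elim(1) A1_unique by blast
    qed
    then have "AE \<omega> in P N. \<omega> \<in> {\<omega> \<in> space (P N). \<mu> N \<omega> \<in> B} \<longleftrightarrow>
        \<omega> \<in> {\<omega> \<in> space (P N). ?\<gamma> \<omega> \<in> A B}"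
      by eventually_elim (auto simp: A_def)
    then have "prob {\<omega> \<in> space (P N). \<mu> N \<omega> \<in> B} = prob {\<omega> \<in> space (P N). ?\<gamma> \<omega> \<in> A B}"
    proof (rule measure_eq_AE)
      show "{\<omega> \<in> space (P N). \<mu> N \<omega> \<in> B} \<in> events"
        using measurable_sets[OF meas_\<mu>[OF N] B] by (simp add: vimage_def Int_def conj_commute)
      show "{\<omega> \<in> space (P N). ?\<gamma> \<omega> \<in> A B} \<in> events"
        using measurable_sets[OF meas_\<gamma> A[OF B]] by (simp add: vimage_def Int_def conj_commute)
    qed
    then show ?thesis using law_\<gamma>[OF A[OF B]] by simp
  qed
  show "large_deviation_principle P \<mu> I"
    unfolding large_deviation_principle_def
  proof (intro conjI allI impI ballI)
    show "rate_function I" using good by (simp add: good_rate_function_def)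
  next
    fix N :: nat assume "1 \<le> N"
    then show "prob_space (P N)" "\<mu> N \<in> borel_measurable (P N)" by (auto intro: P meas_\<mu>)
  next
    fix B :: "'x prob set" assume B: "B \<in> sets borel"
    let ?l = "\<lambda>N. ereal (1 / real N) * log_ereal (measure (P N) {\<omega> \<in> space (P N). \<mu> N \<omega> \<in> B})"
    let ?s = "\<lambda>C N. ereal (1 / real N) * log_ereal (empirical_probability N \<gamma>0 C)"
    have ep_nonneg: "0 \<le> empirical_probability N \<gamma>0 C" for N C by (simp add: empirical_probability_def)
    have "- liminf ?l \<le> (INF x\<in>interior B. I x)"
    proof (intro INF_greatest)
      fix \<eta> assume \<eta>: "\<eta> \<in> interior B"
      show "- liminf ?l \<le> I \<eta>"
        unfolding I_def
      proof (intro INF_greatest)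
        fix \<gamma> assume "\<gamma> \<in> {\<gamma> \<in> D. \<mu>_star \<gamma> = \<eta>}"
        then have \<gamma>: "\<gamma> \<in> D" "\<mu>_star \<gamma> = \<eta>" by auto
        show "- liminf ?l \<le> relative_entropy \<gamma> \<gamma>0"
        proof (cases "relative_entropy \<gamma> \<gamma>0 < \<infinity>")
          case True
          have "\<forall>\<^sub>F x in at \<gamma> within D. \<mu>_star x \<in> interior B"
            using A3[OF True] \<eta> \<gamma> by (intro topological_tendstoD) auto
          then obtain U where U: "open U" "\<gamma> \<in> U"
            "\<And>x. x \<in> U \<Longrightarrow> x \<in> D \<Longrightarrow> x \<noteq> \<gamma> \<Longrightarrow> \<mu>_star x \<in> interior B"
            by (auto simp: eventually_at_topological)
          have UB: "\<mu>_star x \<in> B" if "x \<in> U" "x \<in> D" for x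
            using U(3)[OF that] \<eta> \<gamma> interior_subset by (cases "x = \<gamma>") auto
          have "\<forall>\<^sub>F N in sequentially. ?s U N \<le> ?l N"
            using eventually_ge_at_top[of 1]
          proof eventually_elim
            case (elim N)
            have "AE y in iid N \<gamma>0. empirical_measure N y \<in> U \<longrightarrow> empirical_measure N y \<in> A B"
              using AE_D[OF elim] by eventually_elim (auto simp: A_def UB)
            then have "empirical_probability N \<gamma>0 U \<le> empirical_probability N \<gamma>0 (A B)"
              by (rule empirical_probability_mono_AE[OF elim A[OF B]])
            then show ?case unfolding law[OF B elim] by (rule log_ereal_mono[OF ep_nonneg])
          qed
          then have "liminf (?s U) \<le> liminf ?l" by (rule Liminf_mono)
          with sanov_lower_bound[OF U(1,2), of \<gamma>0] have "- relative_entropy \<gamma> \<gamma>0 \<le> liminf ?l" by (rule order_trans)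
          then show ?thesis by (simp add: ereal_uminus_le_reorder)
        qed simp
      qed
    qed
    then show "- (INF x\<in>interior B. I x) \<le> liminf ?l" by (simp add: ereal_uminus_le_reorder)
    show "limsup ?l \<le> - (INF x\<in>closure B. I x)"
    proof (rule ccontr)
      assume "\<not> ?thesis"
      then have "- limsup ?l < (INF x\<in>closure B. I x)" by (simp add: not_le ereal_uminus_less_reorder)
      \<comment> \<open>A real level strictly in between avoids treating an infinite infimum separately.\<close>
      then obtain c where c: "- limsup ?l < ereal c" "ereal c < (INF x\<in>closure B. I x)"
        using ereal_dense2 by blast
      have "limsup (?s (closure (A B))) \<le> ereal (- c)"
      proof (rule sanov_upper_bound)
        fix \<gamma> assume \<gamma>: "\<gamma> \<in> closure (A B)"
        show "\<not> relative_entropy \<gamma> \<gamma>0 \<le> ereal c"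
        proof
          assume le: "relative_entropy \<gamma> \<gamma>0 \<le> ereal c"
          then have "relative_entropy \<gamma> \<gamma>0 < \<infinity>" by (auto intro: le_less_trans)
          note \<gamma>D = A3[OF this]
          have "\<mu>_star \<gamma> \<in> closure B"
            using limit_point_in_closure_image \<gamma>D \<gamma> unfolding A_def by blast
          then have "(INF x\<in>closure B. I x) \<le> I (\<mu>_star \<gamma>)" by (rule INF_lower)
          also have "\<dots> \<le> relative_entropy \<gamma> \<gamma>0"
            unfolding I_def using \<gamma>D by (intro INF_lower) auto
          finally show False using le c(2) by simp
        qed
      qed simp
      moreover have "limsup ?l \<le> limsup (?s (closure (A B)))"
      proof (rule Limsup_mono)
        show "\<forall>\<^sub>F N in sequentially. ?l N \<le> ?s (closure (A B)) N"
          using eventually_ge_at_top[of 1]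
        proof eventually_elim
          case (elim N)
          have "empirical_probability N \<gamma>0 (A B) \<le> empirical_probability N \<gamma>0 (closure (A B))"
            using closure_subset by (intro empirical_probability_mono_AE[OF elim] AE_I2) auto
          then show ?case unfolding law[OF B elim] by (rule log_ereal_mono[OF ep_nonneg])
        qed
      qed
      ultimately have "limsup ?l \<le> - ereal c" by simp
      then show False using c(1) by (simp add: ereal_uminus_less_reorder ereal_less_uminus_reorder)
    qed
  qed
qed

end
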